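(* Let $\mathcal{F}$ be a relational Fraïssé class, in a countable signature, with the strong amalgamation property. Then the diversification $\mathbb{D}\mathcal{F}$ is a Fraïssé class, and every finite group acts freely on the Fraïssé limit of $\mathbb{D}\mathcal{F}$.
   Context: A class of finitely generated models is a Fraïssé class if it is hereditary, has the joint embedding property, has countably many isomorphism types, and has the amalgamation property. It is relational if its signature has only relation symbols; its models are then finite, and the empty set is allowed as a model. The strong amalgamation property: for all embeddings $f\colon Z\to X$, $g\colon Z\to Y$ in the class there are $W$ in the class and embeddings $f'\colon X\to W$, $g'\colon Y\to W$ with $f'f=g'g$ and $f'[X]\cap g'[Y]=f'f[Z]$. The Fraïssé limit of a Fraïssé class is the unique countable homogeneous structure whose age (the class of all finitely generated structures embeddable into it) is that class. Diversification: let $\mathcal{R}$ be the (countable relational) signature of $\mathcal{F}$. For each $n$-ary $R\in\mathcal{R}$ let $\tilde R$ be an $(n+1)$-ary relation symbol, and let $\tilde{\mathcal{R}}=\{\tilde R: R\in\mathcal{R}\}\cup\{P,C\}$ with $P,C$ unary predicates. $\mathbb{D}\mathcal{F}$ is the class of all finite $\tilde{\mathcal{R}}$-models $X$ such that $\{P^X,C^X\}$ is a partition of $X$ (parts possibly empty), each $\tilde R^X$ is contained in $(P^X)^n\times C^X$, and for each $y\in C^X$ the set $P^X$ endowed with the relations $\tilde R^X(-,y)$, $R\in\mathcal{R}$, is a model in $\mathcal{F}$. An action of a group $G$ on a structure $X$ is an action by automorphisms of $X$; it is free if $x^g=x$ for some $x\in X$ implies $g=1$.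
   Formalization: The class F consisting only of the empty model is excluded: it is a relational Fraïssé class with strong amalgamation, but its diversification lacks joint embedding (a single P-point and a single C-point cannot be jointly embedded). *)

theory Defs
  imports "HOL-Algebra.Group_Action" "HOL-Library.Countable_Set"
begin

section \<open>Relational signatures and models\<close>

text \<open>The symbols form a set rather than a whole type, so that the empty signature is included.\<close>

record 'r signature =
  syms :: "'r set"
  arity :: "'r \<Rightarrow> nat"

record ('r, 'a) model =
  univ :: "'a set"
  rel :: "'r \<Rightarrow> 'a list set"

text \<open>Symbols outside the signature are interpreted by the empty relation, so that equality of
  models is equality of the universe and of the relations named by the signature.\<close>

definition is_model :: "'r signature \<Rightarrow> ('r, 'a) model \<Rightarrow> bool" where
  "is_model S M \<longleftrightarrow>
     (\<forall>R\<in>syms S. rel M R \<subseteq> {xs. set xs \<subseteq> univ M \<and> length xs = arity S R}) \<and>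
     (\<forall>R. R \<notin> syms S \<longrightarrow> rel M R = {})"

definition embedding ::
    "'r signature \<Rightarrow> ('a \<Rightarrow> 'b) \<Rightarrow> ('r, 'a) model \<Rightarrow> ('r, 'b) model \<Rightarrow> bool" where
  "embedding S f M N \<longleftrightarrow>
     f ` univ M \<subseteq> univ N \<and> inj_on f (univ M) \<and>
     (\<forall>R\<in>syms S. \<forall>xs. set xs \<subseteq> univ M \<and> length xs = arity S R \<longrightarrow>
        (xs \<in> rel M R \<longleftrightarrow> map f xs \<in> rel N R))"

definition isomorphism ::
    "'r signature \<Rightarrow> ('a \<Rightarrow> 'b) \<Rightarrow> ('r, 'a) model \<Rightarrow> ('r, 'b) model \<Rightarrow> bool" where
  "isomorphism S f M N \<longleftrightarrow> embedding S f M N \<and> f ` univ M = univ N"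

definition isomorphic :: "'r signature \<Rightarrow> ('r, 'a) model \<Rightarrow> ('r, 'b) model \<Rightarrow> bool" where
  "isomorphic S M N \<longleftrightarrow> (\<exists>f. isomorphism S f M N)"

definition automorphism :: "'r signature \<Rightarrow> ('a \<Rightarrow> 'a) \<Rightarrow> ('r, 'a) model \<Rightarrow> bool" where
  "automorphism S f M \<longleftrightarrow> isomorphism S f M M"

definition submodel :: "('r, 'a) model \<Rightarrow> 'a set \<Rightarrow> ('r, 'a) model" where
  "submodel M A = \<lparr>univ = A, rel = (\<lambda>R. {xs \<in> rel M R. set xs \<subseteq> A})\<rparr>"


section \<open>Fraisse classes\<close>

text \<open>In a relational signature finitely generated means finite. A class of finite models is
  given by its members with universe contained in the natural numbers; being closed under
  isomorphism, it is determined by them.\<close>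

definition finite_model_class :: "'r signature \<Rightarrow> ('r, nat) model set \<Rightarrow> bool" where
  "finite_model_class S K \<longleftrightarrow>
     (\<forall>X\<in>K. is_model S X \<and> finite (univ X)) \<and>
     (\<forall>X\<in>K. \<forall>Y. is_model S Y \<and> isomorphic S X Y \<longrightarrow> Y \<in> K)"

definition hereditary :: "('r, nat) model set \<Rightarrow> bool" where
  "hereditary K \<longleftrightarrow> (\<forall>X\<in>K. \<forall>A. A \<subseteq> univ X \<longrightarrow> submodel X A \<in> K)"

definition joint_embedding :: "'r signature \<Rightarrow> ('r, nat) model set \<Rightarrow> bool" where
  "joint_embedding S K \<longleftrightarrow>
     (\<forall>X\<in>K. \<forall>Y\<in>K. \<exists>W\<in>K. (\<exists>f. embedding S f X W) \<and> (\<exists>g. embedding S g Y W))"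

definition countably_many_iso_types :: "'r signature \<Rightarrow> ('r, nat) model set \<Rightarrow> bool" where
  "countably_many_iso_types S K \<longleftrightarrow>
     countable (K // {(X, Y). X \<in> K \<and> Y \<in> K \<and> isomorphic S X Y})"

definition amalgamation :: "'r signature \<Rightarrow> ('r, nat) model set \<Rightarrow> bool" where
  "amalgamation S K \<longleftrightarrow>
     (\<forall>Z\<in>K. \<forall>X\<in>K. \<forall>Y\<in>K. \<forall>f g. embedding S f Z X \<and> embedding S g Z Y \<longrightarrow>
        (\<exists>W\<in>K. \<exists>f' g'. embedding S f' X W \<and> embedding S g' Y W \<and>
           (\<forall>z\<in>univ Z. f' (f z) = g' (g z))))"

definition strong_amalgamation :: "'r signature \<Rightarrow> ('r, nat) model set \<Rightarrow> bool" where
  "strong_amalgamation S K \<longleftrightarrow>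
     (\<forall>Z\<in>K. \<forall>X\<in>K. \<forall>Y\<in>K. \<forall>f g. embedding S f Z X \<and> embedding S g Z Y \<longrightarrow>
        (\<exists>W\<in>K. \<exists>f' g'. embedding S f' X W \<and> embedding S g' Y W \<and>
           (\<forall>z\<in>univ Z. f' (f z) = g' (g z)) \<and>
           f' ` univ X \<inter> g' ` univ Y = f' ` f ` univ Z))"

definition fraisse_class :: "'r signature \<Rightarrow> ('r, nat) model set \<Rightarrow> bool" where
  "fraisse_class S K \<longleftrightarrow>
     finite_model_class S K \<and> hereditary K \<and> joint_embedding S K \<and>
     countably_many_iso_types S K \<and> amalgamation S K"


section \<open>Fraisse limits\<close>

definition age :: "'r signature \<Rightarrow> ('r, 'a) model \<Rightarrow> ('r, nat) model set" where
  "age S M = {X. is_model S X \<and> finite (univ X) \<and> (\<exists>f. embedding S f X M)}"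

definition homogeneous :: "'r signature \<Rightarrow> ('r, 'a) model \<Rightarrow> bool" where
  "homogeneous S M \<longleftrightarrow>
     (\<forall>A B f. A \<subseteq> univ M \<and> finite A \<and> B \<subseteq> univ M \<and> finite B \<and>
        isomorphism S f (submodel M A) (submodel M B) \<longrightarrow>
        (\<exists>h. automorphism S h M \<and> (\<forall>a\<in>A. h a = f a)))"

definition fraisse_limit :: "'r signature \<Rightarrow> ('r, nat) model set \<Rightarrow> ('r, 'a) model \<Rightarrow> bool" where
  "fraisse_limit S K M \<longleftrightarrow>
     is_model S M \<and> countable (univ M) \<and> homogeneous S M \<and> age S M = K"


section \<open>Diversification\<close>

datatype 'r div_sym = Tilde 'r | SymP | SymC

definition div_signature :: "'r signature \<Rightarrow> 'r div_sym signature" where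
  "div_signature S =
     \<lparr>syms = Tilde ` syms S \<union> {SymP, SymC},
      arity = (\<lambda>T. case T of Tilde R \<Rightarrow> Suc (arity S R) | SymP \<Rightarrow> 1 | SymC \<Rightarrow> 1)\<rparr>"

definition Ppart :: "('r div_sym, 'a) model \<Rightarrow> 'a set" where
  "Ppart X = {x. [x] \<in> rel X SymP}"

definition Cpart :: "('r div_sym, 'a) model \<Rightarrow> 'a set" where
  "Cpart X = {x. [x] \<in> rel X SymC}"

text \<open>The element of the C-part is the last entry of a tuple in a relation \<open>Tilde R\<close>.\<close>

definition fibre :: "('r div_sym, 'a) model \<Rightarrow> 'a \<Rightarrow> ('r, 'a) model" where
  "fibre X y = \<lparr>univ = Ppart X, rel = (\<lambda>R. {xs. xs @ [y] \<in> rel X (Tilde R)})\<rparr>"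

definition diversification ::
    "'r signature \<Rightarrow> ('r, nat) model set \<Rightarrow> ('r div_sym, nat) model set" where
  "diversification S F =
     {X. is_model (div_signature S) X \<and> finite (univ X) \<and>
         Ppart X \<union> Cpart X = univ X \<and> Ppart X \<inter> Cpart X = {} \<and>
         (\<forall>R\<in>syms S. rel X (Tilde R) \<subseteq>
            {xs @ [y] | xs y. set xs \<subseteq> Ppart X \<and> length xs = arity S R \<and> y \<in> Cpart X}) \<and>
         (\<forall>y\<in>Cpart X. fibre X y \<in> F)}"


section \<open>Free actions\<close>

definition acts_freely :: "('g, 'm) monoid_scheme \<Rightarrow> 'r signature \<Rightarrow> ('r, 'a) model \<Rightarrow> bool" where
  "acts_freely G S M \<longleftrightarrow>
     (\<exists>\<phi>. group_action G (univ M) \<phi> \<and>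
          (\<forall>g\<in>carrier G. automorphism S (\<phi> g) M) \<and>
          (\<forall>g\<in>carrier G. \<forall>x\<in>univ M. \<phi> g x = x \<longrightarrow> g = \<one>\<^bsub>G\<^esub>))"

end

theory Submission
  imports Defs "HOL-Analysis.Finite_Cartesian_Product"
begin

text \<open>Amalgamation in the diversification is done fibrewise: over a common point of the C-parts one
  amalgamates the two fibres strongly, and over any other point one extends the given fibre to the
  union of the P-parts, which is possible because the class has a nonempty member.

  A finite group \<open>G\<close> is made to act on the limit by back-and-forth on finite subsets with a free
  partial action, adding one regular orbit at a time. If the new point lies in the C-part, the fibres
  over its orbit are translates of one fibre. If it lies in the P-part, then for a representative
  \<open>t\<close> of each orbit in the old C-part the fibre over \<open>t\<close> has to extend \<open>|G|\<close> prescribed one-point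
  extensions (the translates of the given fibres over the orbit of \<open>t\<close>); it exists by strong
  amalgamation. As the action on the C-part is free, translating it over the orbit is unambiguous.\<close>

section \<open>Models and embeddings\<close>

text \<open>What shapes the argument is that the fibres of a model share one P-part but are
  otherwise unrelated. They are amalgamated independently of each other, so plain amalgamation would
  not do: it might identify two points in one fibre and keep them apart in another, and no common
  P-part would remain. Strong amalgamation identifies nothing beyond the common part, so all fibres
  can be given the same universe. For the same reason the images of a new point under the group stay
  distinct in every fibre. A nonempty member is required: if the empty model were the only member, a
  single P-point and a single C-point would both be models of the diversification, but no model
  could contain both, and joint embedding would fail. The limit enters only through its extension
  property and its age. A finite extension can thus be built abstractly, with new points named
  freely, and be embedded afterwards over the part already present.\<close>

lemma submodel_simps [simp]:
  "univ (submodel M A) = A" "xs \<in> rel (submodel M A) R \<longleftrightarrow> xs \<in> rel M R \<and> set xs \<subseteq> A"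
  by (auto simp: submodel_def)

lemma submodel_submodel: "A \<subseteq> B \<Longrightarrow> submodel (submodel M B) A = submodel M A"
  by (auto simp: submodel_def)

lemma is_modelD:
  assumes "is_model S M" "xs \<in> rel M R"
  shows "R \<in> syms S" "set xs \<subseteq> univ M" "length xs = arity S R"
  using assms unfolding is_model_def by blast+

lemma is_model_submodel: "is_model S M \<Longrightarrow> is_model S (submodel M A)"
  unfolding is_model_def submodel_def by auto

lemma submodel_univ: "is_model S M \<Longrightarrow> submodel M (univ M) = M"
  by (rule model.equality) (auto simp: submodel_def dest: is_modelD)

lemma model_eqI:
  assumes "is_model S X" "is_model S Y" "univ X = univ Y"
    and "\<And>R xs. R \<in> syms S \<Longrightarrow> set xs \<subseteq> univ X \<Longrightarrow> length xs = arity S R \<Longrightarrow>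
      xs \<in> rel X R \<longleftrightarrow> xs \<in> rel Y R"
  shows "X = Y"
proof (rule model.equality)
  show "rel X = rel Y"
  proof
    fix R
    show "rel X R = rel Y R"
      using assms(3,4) is_modelD[OF assms(1)] is_modelD[OF assms(2)] by blast
  qed
qed (use assms(3) in auto)

lemma embeddingD:
  assumes "embedding S f M N"
  shows "f ` univ M \<subseteq> univ N" "inj_on f (univ M)"
    "R \<in> syms S \<Longrightarrow> set xs \<subseteq> univ M \<Longrightarrow> length xs = arity S R \<Longrightarrow>
      map f xs \<in> rel N R \<longleftrightarrow> xs \<in> rel M R"
  using assms unfolding embedding_def by auto

lemma embedding_comp:
  assumes f: "embedding S f M N" and g: "embedding S g N Q"
  shows "embedding S (\<lambda>x. g (f x)) M Q"
  unfolding embedding_def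
proof (intro conjI ballI allI impI)
  show "(\<lambda>x. g (f x)) ` univ M \<subseteq> univ Q"
    using embeddingD(1)[OF f] embeddingD(1)[OF g] by blast
  show "inj_on (\<lambda>x. g (f x)) (univ M)"
    using embeddingD(1,2)[OF f] embeddingD(2)[OF g] by (auto simp: inj_on_def image_subset_iff)
  fix R xs assume R: "R \<in> syms S" and xs: "set xs \<subseteq> univ M \<and> length xs = arity S R"
  have "set (map f xs) \<subseteq> univ N" using embeddingD(1)[OF f] xs by auto
  then have "map g (map f xs) \<in> rel Q R \<longleftrightarrow> map f xs \<in> rel N R"
    by (rule embeddingD(3)[OF g R]) (use xs in auto)
  then show "xs \<in> rel M R \<longleftrightarrow> map (\<lambda>x. g (f x)) xs \<in> rel Q R"
    using embeddingD(3)[OF f R] xs by (simp add: comp_def)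
qed

lemma embedding_cong:
  assumes "embedding S f M N" "\<And>x. x \<in> univ M \<Longrightarrow> f x = g x"
  shows "embedding S g M N"
proof -
  have "map f xs = map g xs" if "set xs \<subseteq> univ M" for xs
    using that assms(2) by (auto intro!: map_cong)
  moreover have "f ` univ M = g ` univ M" "inj_on f (univ M) = inj_on g (univ M)"
    using assms(2) by (auto cong: image_cong inj_on_cong)
  ultimately show ?thesis using assms(1) unfolding embedding_def by metis
qed

lemma embedding_submodel_domain:
  assumes "embedding S f M N" "A \<subseteq> univ M"
  shows "embedding S f (submodel M A) N"
  using assms unfolding embedding_def by (auto intro: inj_on_subset)

lemma embedding_into_submodel:
  assumes "embedding S f X M" "f ` univ X \<subseteq> A"
  shows "embedding S f X (submodel M A)"
  using assms unfolding embedding_def by (auto simp: image_subset_iff subset_iff)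

lemma embedding_from_submodel:
  assumes "embedding S f X (submodel M A)" "A \<subseteq> univ M"
  shows "embedding S f X M"
  unfolding embedding_def
proof (intro conjI ballI allI impI)
  fix R xs assume "R \<in> syms S" "set xs \<subseteq> univ X \<and> length xs = arity S R"
  moreover from this have "set (map f xs) \<subseteq> A"
    using embeddingD(1)[OF assms(1)] by auto
  ultimately show "xs \<in> rel X R \<longleftrightarrow> map f xs \<in> rel M R"
    using embeddingD(3)[OF assms(1), of R xs] by simp
qed (use embeddingD(1,2)[OF assms(1)] assms(2) in auto)

lemma embedding_inclusion:
  assumes "univ X \<subseteq> univ W" "submodel W (univ X) = X"
  shows "embedding S (\<lambda>x. x) X W"
proof -
  have "xs \<in> rel X R \<longleftrightarrow> xs \<in> rel W R \<and> set xs \<subseteq> univ X" for R xs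
    using submodel_simps(2)[of xs W "univ X" R] assms(2) by simp
  with assms(1) show ?thesis unfolding embedding_def by auto
qed

lemma isomorphism_inverse:
  assumes "isomorphism S f M N"
  shows "isomorphism S (inv_into (univ M) f) N M"
proof -
  have e: "embedding S f M N" and im: "f ` univ M = univ N"
    using assms by (auto simp: isomorphism_def)
  let ?i = "inv_into (univ M) f"
  have bij: "bij_betw f (univ M) (univ N)"
    using embeddingD(2)[OF e] im by (simp add: bij_betw_def)
  have bi: "bij_betw ?i (univ N) (univ M)" by (rule bij_betw_inv_into[OF bij])
  have "embedding S ?i N M" unfolding embedding_def
  proof (intro conjI ballI allI impI)
    fix R xs assume R: "R \<in> syms S" and xs: "set xs \<subseteq> univ N \<and> length xs = arity S R"
    have "map f (map ?i xs) = xs"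
      unfolding map_map comp_def by (rule map_idI) (use xs im in \<open>auto simp: f_inv_into_f\<close>)
    moreover have "set (map ?i xs) \<subseteq> univ M"
      using bi xs unfolding bij_betw_def by auto
    ultimately show "xs \<in> rel N R \<longleftrightarrow> map ?i xs \<in> rel M R"
      using embeddingD(3)[OF e R, of "map ?i xs"] xs by simp
  qed (use bi in \<open>auto simp: bij_betw_def\<close>)
  with bi show ?thesis by (simp add: isomorphism_def bij_betw_def)
qed

lemma isomorphism_onto_image:
  assumes "embedding S f X M"
  shows "isomorphism S f X (submodel M (f ` univ X))"
  using embedding_into_submodel[OF assms] by (simp add: isomorphism_def)

text \<open>Points are renamed by pulling a structure back along an injection; this is how amalgams
  are made to contain the given models as literal submodels. The guards on symbol, entries and arity
  make the result a model for every \<open>k\<close> and \<open>W\<close>.\<close>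

definition pullback :: "'r signature \<Rightarrow> ('a \<Rightarrow> 'b) \<Rightarrow> 'a set \<Rightarrow> ('r, 'b) model \<Rightarrow> ('r, 'a) model" where
  "pullback S k U W = \<lparr>univ = U, rel = (\<lambda>R. {xs. R \<in> syms S \<and> set xs \<subseteq> U \<and>
     length xs = arity S R \<and> map k xs \<in> rel W R})\<rparr>"

lemma pullback_simps [simp]:
  "univ (pullback S k U W) = U"
  "xs \<in> rel (pullback S k U W) R \<longleftrightarrow>
     R \<in> syms S \<and> set xs \<subseteq> U \<and> length xs = arity S R \<and> map k xs \<in> rel W R"
  by (auto simp: pullback_def)

lemma is_model_pullback: "is_model S (pullback S k U W)"
  by (auto simp: is_model_def)

lemma embedding_pullback:
  assumes "inj_on k U" "k ` U \<subseteq> univ W"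
  shows "embedding S k (pullback S k U W) W"
  using assms by (auto simp: embedding_def)

lemma submodel_pullback:
  assumes X: "is_model S X" and f: "embedding S f X W" and UX: "univ X \<subseteq> U"
    and fk: "\<And>x. x \<in> univ X \<Longrightarrow> k x = f x"
  shows "submodel (pullback S k U W) (univ X) = X"
proof (rule model_eqI)
  fix R xs assume R: "R \<in> syms S" and *: "set xs \<subseteq> univ (submodel (pullback S k U W) (univ X))"
    "length xs = arity S R"
  then have eq: "map k xs = map f xs" using fk by auto
  have "map k xs \<in> rel W R \<longleftrightarrow> xs \<in> rel X R"
    unfolding eq using embeddingD(3)[OF f R, of xs] * by simp
  then show "xs \<in> rel (submodel (pullback S k U W) (univ X)) R \<longleftrightarrow> xs \<in> rel X R"
    using * R UX by auto
qed (auto intro: is_model_submodel is_model_pullback X)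

text \<open>The proof scheme of the Rasiowa-Sikorski lemma: a chain meeting countably many dense sets.\<close>

lemma generic_chain:
  assumes p0: "P p0" and refl: "\<And>p. P p \<Longrightarrow> below p p"
    and trans: "\<And>p q r. below p q \<Longrightarrow> below q r \<Longrightarrow> below p r"
    and dense: "\<And>n p. P p \<Longrightarrow> \<exists>q. P q \<and> below p q \<and> D n q"
  obtains s :: "nat \<Rightarrow> 'p" where "s 0 = p0" "\<And>n. P (s n)" "\<And>m n. m \<le> n \<Longrightarrow> below (s m) (s n)"
    "\<And>n. D n (s (Suc n))"
proof -
  have "\<exists>s. \<forall>n. (P (s n) \<and> (n = 0 \<longrightarrow> s n = p0)) \<and> (below (s n) (s (Suc n)) \<and> D n (s (Suc n)))"
    by (rule dependent_nat_choice) (use p0 dense in auto)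
  then obtain s where s: "s 0 = p0" "\<And>n. P (s n)" "\<And>n. below (s n) (s (Suc n))" "\<And>n. D n (s (Suc n))"
    by auto
  have "below (s m) (s n)" if "m \<le> n" for m n
    using that by (induction rule: dec_induct) (auto intro: refl trans s)
  with s that show ?thesis by blast
qed

lemma finite_subset_chain:
  fixes U :: "nat \<Rightarrow> 'a set"
  assumes mono: "\<And>m n. m \<le> n \<Longrightarrow> U m \<subseteq> U n" and fin: "finite A" and A: "A \<subseteq> (\<Union>n. U n)"
  obtains n where "A \<subseteq> U n"
proof -
  have "\<exists>n. A \<subseteq> U n" using fin A
  proof (induction A rule: finite_induct)
    case (insert x A)
    then obtain m n where "x \<in> U m" "A \<subseteq> U n" by auto
    then have "insert x A \<subseteq> U (max m n)"
      using mono[of m "max m n"] mono[of n "max m n"] by auto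
    then show ?case ..
  qed auto
  with that show ?thesis by blast
qed

section \<open>Hereditary classes\<close>

definition agree :: "('r, nat) model \<Rightarrow> ('r, nat) model \<Rightarrow> bool" where
  "agree X Y \<longleftrightarrow> submodel X (univ X \<inter> univ Y) = submodel Y (univ X \<inter> univ Y)"

text \<open>Amalgamation over inclusions; it covers strong amalgamation, since the universe of the
  amalgam is exactly the union.\<close>

definition union_amalgamation :: "('r, nat) model set \<Rightarrow> bool" where
  "union_amalgamation K \<longleftrightarrow> (\<forall>X\<in>K. \<forall>Y\<in>K. agree X Y \<longrightarrow>
     (\<exists>W\<in>K. univ W = univ X \<union> univ Y \<and> submodel W (univ X) = X \<and> submodel W (univ Y) = Y))"

locale hereditary_class =
  fixes S :: "'r signature" and K :: "('r, nat) model set"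
  assumes fmc: "finite_model_class S K" and hered: "hereditary K"
begin

lemma K_model: "X \<in> K \<Longrightarrow> is_model S X" and K_finite: "X \<in> K \<Longrightarrow> finite (univ X)"
  using fmc by (auto simp: finite_model_class_def)

lemma K_submodel: "X \<in> K \<Longrightarrow> A \<subseteq> univ X \<Longrightarrow> submodel X A \<in> K"
  using hered by (auto simp: hereditary_def)

lemma K_embed:
  assumes X: "X \<in> K" and Y: "is_model S Y" and f: "embedding S f Y X"
  shows "Y \<in> K"
proof -
  have "submodel X (f ` univ Y) \<in> K" using K_submodel[OF X embeddingD(1)[OF f]] .
  moreover have "isomorphic S (submodel X (f ` univ Y)) Y"
    unfolding isomorphic_def using isomorphism_inverse[OF isomorphism_onto_image[OF f]] by blast
  ultimately show ?thesis using fmc Y unfolding finite_model_class_def by blast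
qed

lemma K_pullback:
  "X \<in> K \<Longrightarrow> inj_on k U \<Longrightarrow> k ` U \<subseteq> univ X \<Longrightarrow> pullback S k U X \<in> K"
  by (rule K_embed[OF _ is_model_pullback embedding_pullback])

text \<open>The strong amalgam over the common part \<open>Z\<close> glues \<open>f\<close> and
  \<open>g\<close> to one map \<open>k\<close> on the union of the universes. It is injective
  because the two images meet only in the image of \<open>Z\<close>, so the amalgam can be pulled
  back along it to the union itself.\<close>

lemma union_amalgamation_if_strong:
  assumes "strong_amalgamation S K"
  shows "union_amalgamation K"
  unfolding union_amalgamation_def
proof (intro ballI impI)
  fix X Y assume X: "X \<in> K" and Y: "Y \<in> K" and ag: "agree X Y"
  define Z where "Z = submodel X (univ X \<inter> univ Y)"
  have ZY: "Z = submodel Y (univ X \<inter> univ Y)" using ag by (simp add: Z_def agree_def)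
  have Z: "Z \<in> K" unfolding Z_def by (rule K_submodel[OF X]) auto
  have incX: "embedding S (\<lambda>x. x) Z X"
    unfolding Z_def by (rule embedding_inclusion) auto
  have incY: "embedding S (\<lambda>x. x) Z Y"
    unfolding ZY by (rule embedding_inclusion) auto
  obtain W f g where W: "W \<in> K" and f: "embedding S f X W" and g: "embedding S g Y W"
    and fg: "\<forall>z\<in>univ Z. f z = g z"
    and strong: "f ` univ X \<inter> g ` univ Y = f ` (\<lambda>x. x) ` univ Z"
    using assms[unfolded strong_amalgamation_def, rule_format, OF Z X Y conjI[OF incX incY]]
    by (elim bexE exE conjE)
  have fgI: "f z = g z" if "z \<in> univ X" "z \<in> univ Y" for z
    using fg that by (simp add: Z_def)
  define k where "k x = (if x \<in> univ X then f x else g x)" for x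
  have kf: "k x = f x" if "x \<in> univ X" for x using that by (simp add: k_def)
  have kg: "k x = g x" if "x \<in> univ Y" for x using that fgI by (simp add: k_def)
  \<comment> \<open>The one use of strongness: a point of \<open>X\<close> and a point of
    \<open>Y\<close> with the same image come from a single point of \<open>Z\<close>.\<close>
  have cross: "x = y" if "x \<in> univ X" "y \<in> univ Y" "f x = g y" for x y
  proof -
    have "f x \<in> f ` univ X \<inter> g ` univ Y" using that by (metis IntI imageI)
    then have "f x \<in> f ` univ Z" using strong by simp
    then obtain z where z: "z \<in> univ X" "z \<in> univ Y" "f x = f z" by (auto simp: Z_def)
    then have "x = z" using embeddingD(2)[OF f] that by (auto dest: inj_onD)
    moreover have "y = z" using embeddingD(2)[OF g] that z fgI by (auto dest: inj_onD)
    ultimately show ?thesis by simp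
  qed
  have inj: "inj_on k (univ X \<union> univ Y)"
  proof (rule inj_onI)
    fix x y assume *: "x \<in> univ X \<union> univ Y" "y \<in> univ X \<union> univ Y" "k x = k y"
    show "x = y"
      using * embeddingD(2)[OF f] embeddingD(2)[OF g] cross[of x y] cross[of y x] kf kg
      by (metis Un_iff inj_on_def)
  qed
  have im: "k ` (univ X \<union> univ Y) \<subseteq> univ W"
    using embeddingD(1)[OF f] embeddingD(1)[OF g] kf kg by (auto simp: image_subset_iff)
  let ?W = "pullback S k (univ X \<union> univ Y) W"
  have "?W \<in> K" by (rule K_pullback[OF W inj im])
  moreover have "submodel ?W (univ X) = X"
    by (rule submodel_pullback[OF K_model[OF X] f]) (auto simp: kf)
  moreover have "submodel ?W (univ Y) = Y"
    by (rule submodel_pullback[OF K_model[OF Y] g]) (auto simp: kg)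
  ultimately show "\<exists>W\<in>K. univ W = univ X \<union> univ Y \<and> submodel W (univ X) = X \<and> submodel W (univ Y) = Y"
    by (intro bexI[of _ ?W]) auto
qed

text \<open>In this form one leg of the amalgam is an inclusion, as needed to grow a chain of
  models, while the other model matters only up to isomorphism. It is replaced by a copy
  \<open>Y'\<close> that meets \<open>X\<close> exactly in the image of \<open>Z\<close>, so that
  union amalgamation applies.\<close>

lemma amalgam_over_inclusion:
  assumes ua: "union_amalgamation K" and X: "X \<in> K" and Y: "Y \<in> K"
    and f: "embedding S f Z X" and g: "embedding S g Z Y"
  obtains W h where "W \<in> K" "univ X \<subseteq> univ W" "submodel W (univ X) = X" "embedding S h Y W"
    "\<And>z. z \<in> univ Z \<Longrightarrow> h (g z) = f z"
proof -
  obtain b where b: "\<And>x. x \<in> univ X \<Longrightarrow> x < b"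
    using finite_nat_set_iff_bounded K_finite[OF X] by metis
  let ?i = "inv_into (univ Z) g"
  \<comment> \<open>Points coming from \<open>Z\<close> receive their names in \<open>X\<close>; the
    others are shifted by the bound \<open>b\<close>, beyond every element of
    \<open>X\<close>.\<close>
  define j where "j y = (if y \<in> g ` univ Z then f (?i y) else b + y)" for y
  have jg: "j (g z) = f z" if "z \<in> univ Z" for z
    using that embeddingD(2)[OF g] by (simp add: j_def)
  have jX: "y \<in> g ` univ Z" if "j y \<in> univ X" for y
    using b[OF that] by (auto simp: j_def split: if_splits)
  have inj: "inj_on j (univ Y)"
  proof (rule inj_onI)
    fix x y assume *: "x \<in> univ Y" "y \<in> univ Y" "j x = j y"
    show "x = y"
    proof (cases "j x \<in> univ X")
      case True
      then obtain u v where "x = g u" "y = g v" "u \<in> univ Z" "v \<in> univ Z" using jX * by (metis imageE)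
      moreover from this have "u = v" using * jg embeddingD(2)[OF f] by (metis inj_onD)
      ultimately show ?thesis by simp
    next
      case False
      then have "x \<notin> g ` univ Z" "y \<notin> g ` univ Z"
        using * jg embeddingD(1)[OF f] by (metis imageE image_subset_iff)+
      with * show ?thesis by (simp add: j_def)
    qed
  qed
  define k where "k = inv_into (univ Y) j"
  define Y' where "Y' = pullback S k (j ` univ Y) Y"
  have kj: "k (j y) = y" if "y \<in> univ Y" for y using that inj by (simp add: k_def)
  have Y': "Y' \<in> K" unfolding Y'_def
    by (rule K_pullback[OF Y]) (auto simp: kj intro!: inj_onI)
  have jY: "embedding S j Y Y'" unfolding embedding_def
  proof (intro conjI ballI allI impI inj)
    fix R xs assume *: "R \<in> syms S" "set xs \<subseteq> univ Y \<and> length xs = arity S R"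
    have "map k (map j xs) = xs" using * kj by (auto intro!: map_idI)
    with * show "xs \<in> rel Y R \<longleftrightarrow> map j xs \<in> rel Y' R" by (auto simp: Y'_def)
  qed (auto simp: Y'_def)
  have inter: "univ X \<inter> univ Y' = f ` univ Z"
  proof
    show "univ X \<inter> univ Y' \<subseteq> f ` univ Z"
    proof
      fix x assume x: "x \<in> univ X \<inter> univ Y'"
      then obtain y where y: "x = j y" by (auto simp: Y'_def)
      then obtain z where "z \<in> univ Z" "y = g z" using jX x by blast
      then show "x \<in> f ` univ Z" using y jg by auto
    qed
    show "f ` univ Z \<subseteq> univ X \<inter> univ Y'"
    proof
      fix x assume "x \<in> f ` univ Z"
      then obtain z where z: "z \<in> univ Z" "x = f z" by auto
      then have "x \<in> univ X" "g z \<in> univ Y" using embeddingD(1)[OF f] embeddingD(1)[OF g] by auto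
      then show "x \<in> univ X \<inter> univ Y'" using jg[OF z(1)] z(2) by (metis IntI Y'_def imageI pullback_simps(1))
    qed
  qed
  have "agree X Y'" unfolding agree_def inter
  proof (rule model_eqI)
    fix R xs assume R: "R \<in> syms S" and *: "set xs \<subseteq> univ (submodel X (f ` univ Z))" "length xs = arity S R"
    then have "xs \<in> lists (f ` univ Z)" by auto
    then obtain zs where zs: "set zs \<subseteq> univ Z" "xs = map f zs" by (auto simp: lists_image)
    then have eq: "xs = map j (map g zs)" using jg by auto
    have gzs: "set (map g zs) \<subseteq> univ Y" using zs embeddingD(1)[OF g] by auto
    have len: "length zs = arity S R" using zs * by simp
    have "xs \<in> rel X R \<longleftrightarrow> zs \<in> rel Z R"
      using embeddingD(3)[OF f R zs(1) len] zs(2) by simp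
    also have "\<dots> \<longleftrightarrow> map g zs \<in> rel Y R"
      using embeddingD(3)[OF g R zs(1) len] by simp
    also have "\<dots> \<longleftrightarrow> xs \<in> rel Y' R"
      unfolding eq using embeddingD(3)[OF jY R gzs] len by simp
    finally show "xs \<in> rel (submodel X (f ` univ Z)) R \<longleftrightarrow> xs \<in> rel (submodel Y' (f ` univ Z)) R"
      by simp
  qed (use K_model X Y' in \<open>auto intro: is_model_submodel\<close>)
  then obtain W where W: "W \<in> K" "univ W = univ X \<union> univ Y'" "submodel W (univ X) = X" "submodel W (univ Y') = Y'"
    using ua X Y' unfolding union_amalgamation_def by blast
  have "embedding S (\<lambda>x. x) Y' W" using W by (intro embedding_inclusion) auto
  from embedding_comp[OF jY this] W jg show ?thesis by (intro that[of W j]) auto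
qed

lemma amalgamation_if_union_amalgamation:
  assumes "union_amalgamation K"
  shows "amalgamation S K"
  unfolding amalgamation_def
proof (intro ballI allI impI, elim conjE)
  fix Z X Y f g
  assume *: "Z \<in> K" "X \<in> K" "Y \<in> K" "embedding S f Z X" "embedding S g Z Y"
  obtain W h where "W \<in> K" "univ X \<subseteq> univ W" "submodel W (univ X) = X" "embedding S h Y W"
    "\<And>z. z \<in> univ Z \<Longrightarrow> h (g z) = f z"
    using amalgam_over_inclusion[OF assms *(2-5)] by metis
  then show "\<exists>W\<in>K. \<exists>f' g'. embedding S f' X W \<and> embedding S g' Y W \<and> (\<forall>z\<in>univ Z. f' (f z) = g' (g z))"
    using embedding_inclusion by (intro bexI[of _ W] exI[of _ "\<lambda>x. x"] exI[of _ h]) auto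
qed

text \<open>An isomorphic copy of a finite \<open>X\<close> with universe in the naturals is
  determined by a map from \<open>univ X\<close> to the naturals, and there are countably many of
  these. So each isomorphism class is countable, and countably many classes give a countable
  \<open>K\<close>.\<close>

lemma countable_class:
  assumes "countably_many_iso_types S K"
  shows "countable K"
proof -
  define r where "r = {(X, Y). X \<in> K \<and> Y \<in> K \<and> isomorphic S X Y}"
  define push where "push X f = \<lparr>univ = f ` univ X, rel = (\<lambda>R. map f ` rel X R)\<rparr>"
    for X :: "('r, nat) model" and f :: "nat \<Rightarrow> nat"
  have class_countable: "countable (r `` {X})" if X: "X \<in> K" for X
  proof (rule countable_subset)
    show "r `` {X} \<subseteq> push X ` (univ X \<rightarrow>\<^sub>E UNIV)"
    proof
      fix Y assume "Y \<in> r `` {X}"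
      then obtain f where Y: "Y \<in> K" and f: "embedding S f X Y" and im: "f ` univ X = univ Y"
        by (auto simp: r_def isomorphic_def isomorphism_def)
      \<comment> \<open>Off \<open>univ X\<close> the map is fixed, so that it ranges over the
        countable set of extensional functions.\<close>
      let ?f = "restrict f (univ X)"
      have eq: "map ?f xs = map f xs" if "set xs \<subseteq> univ X" for xs using that by auto
      have "Y = push X ?f"
      proof (rule model.equality)
        have "ys \<in> rel Y R \<longleftrightarrow> ys \<in> map ?f ` rel X R" for R ys
        proof
          assume ys: "ys \<in> rel Y R"
          note D = is_modelD[OF K_model[OF Y] ys]
          from D(2) have "ys \<in> lists (f ` univ X)" by (auto simp: im)
          then obtain xs where xs: "set xs \<subseteq> univ X" "ys = map f xs" by (auto simp: lists_image)
          then show "ys \<in> map ?f ` rel X R"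
            using embeddingD(3)[OF f D(1) xs(1)] D(3) ys eq[OF xs(1)] by (metis imageI length_map)
        next
          assume "ys \<in> map ?f ` rel X R"
          then obtain xs where xs: "xs \<in> rel X R" "ys = map ?f xs" by auto
          note D = is_modelD[OF K_model[OF X] xs(1)]
          show "ys \<in> rel Y R" using embeddingD(3)[OF f D] xs eq[OF D(2)] by simp
        qed
        then show "rel Y = rel (push X ?f)" by (auto simp: push_def)
      qed (auto simp: push_def im)
      moreover have "?f \<in> univ X \<rightarrow>\<^sub>E UNIV" by simp
      ultimately show "Y \<in> push X ` (univ X \<rightarrow>\<^sub>E UNIV)" by (metis imageI)
    qed
    show "countable (push X ` (univ X \<rightarrow>\<^sub>E (UNIV :: nat set)))"
      by (intro countable_image countable_PiE K_finite X) auto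
  qed
  have id: "isomorphic S X X" for X
    unfolding isomorphic_def isomorphism_def embedding_def by (rule exI[of _ "\<lambda>x. x"]) auto
  have "K \<subseteq> \<Union> (K // r)"
    using id by (auto simp: quotient_def r_def)
  moreover have "countable (\<Union>c\<in>K // r. c)"
  proof (rule countable_UN)
    show "countable (K // r)" using assms by (simp add: countably_many_iso_types_def r_def)
  qed (auto simp: quotient_def class_countable)
  ultimately show ?thesis by (simp add: countable_subset)
qed

end

lemma countably_many_iso_types_if_countable:
  "countable K \<Longrightarrow> countably_many_iso_types S K"
  by (auto simp: countably_many_iso_types_def quotient_def)

section \<open>Rich models and Fraisse limits\<close>

text \<open>The extension property, through which the limit is handled in all constructions.
  Starting from the empty set as \<open>A\<close> it yields embeddings of members of
  \<open>K\<close>; with a finite submodel of \<open>M\<close> as \<open>B\<close> it is the forth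
  step of back-and-forth.\<close>

definition rich :: "'r signature \<Rightarrow> ('r, nat) model set \<Rightarrow> ('r, 'a) model \<Rightarrow> bool" where
  "rich S K M \<longleftrightarrow> (\<forall>B\<in>K. \<forall>A f. A \<subseteq> univ B \<and> embedding S f (submodel B A) M \<longrightarrow>
     (\<exists>h. embedding S h B M \<and> (\<forall>a\<in>A. h a = f a)))"

text \<open>Since \<open>B\<close> is in the age it has some embedding \<open>e\<close>. The map
  \<open>f\<close> after the inverse of \<open>e\<close> is an isomorphism between two finite
  submodels of \<open>M\<close>, the images of \<open>A\<close> under \<open>e\<close> and under
  \<open>f\<close>; an automorphism extending it corrects \<open>e\<close> to an embedding that
  agrees with \<open>f\<close> on \<open>A\<close>.\<close>

lemma rich_if_limit:
  assumes fin: "finite_model_class S K" and M: "fraisse_limit S K M"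
  shows "rich S K M"
  unfolding rich_def
proof (intro ballI allI impI, elim conjE)
  fix B A f assume B: "B \<in> K" and A: "A \<subseteq> univ B" and f: "embedding S f (submodel B A) M"
  obtain e where e: "embedding S e B M" using M B by (auto simp: fraisse_limit_def age_def)
  have finA: "finite A" using fin B A finite_subset unfolding finite_model_class_def by blast
  have eA: "embedding S e (submodel B A) M" by (rule embedding_submodel_domain[OF e A])
  have injA: "inj_on e A" using embeddingD(2)[OF eA] by simp
  have i: "isomorphism S (inv_into A e) (submodel M (e ` A)) (submodel B A)"
    using isomorphism_inverse[OF isomorphism_onto_image[OF eA]] by (simp only: submodel_simps)
  have "embedding S (\<lambda>x. f (inv_into A e x)) (submodel M (e ` A)) (submodel M (f ` A))"
  proof (rule embedding_comp[where f = "inv_into A e" and N = "submodel B A" and g = f])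
    show "embedding S (inv_into A e) (submodel M (e ` A)) (submodel B A)"
      using i by (simp only: isomorphism_def)
    show "embedding S f (submodel B A) (submodel M (f ` A))"
      using isomorphism_onto_image[OF f] by (simp only: isomorphism_def submodel_simps)
  qed
  moreover have "(\<lambda>x. f (inv_into A e x)) ` e ` A = f ` A"
    unfolding image_image using injA by (intro image_cong) auto
  ultimately have "isomorphism S (\<lambda>x. f (inv_into A e x)) (submodel M (e ` A)) (submodel M (f ` A))"
    by (simp add: isomorphism_def)
  then obtain h where h: "automorphism S h M" "\<And>y. y \<in> e ` A \<Longrightarrow> h y = f (inv_into A e y)"
    using M embeddingD(1)[OF eA] embeddingD(1)[OF f] finA
    unfolding fraisse_limit_def homogeneous_def submodel_simps by (metis finite_imageI)
  have "embedding S (\<lambda>x. h (e x)) B M"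
    using h(1) by (intro embedding_comp[OF e]) (auto simp: automorphism_def isomorphism_def)
  moreover have "h (e a) = f a" if "a \<in> A" for a
    using that h(2)[of "e a"] injA by simp
  ultimately show "\<exists>h. embedding S h B M \<and> (\<forall>a\<in>A. h a = f a)" by (intro exI[of _ "\<lambda>x. h (e x)"]) auto
qed

text \<open>Partial isomorphisms are represented by their graphs, so that the back step of
  back-and-forth is the forth step for the converse.\<close>

definition partial_iso :: "'r signature \<Rightarrow> ('r, 'a) model \<Rightarrow> ('a \<times> 'a) set \<Rightarrow> bool" where
  "partial_iso S M p \<longleftrightarrow> p \<subseteq> univ M \<times> univ M \<and>
     (\<forall>u\<in>p. \<forall>v\<in>p. fst u = fst v \<longleftrightarrow> snd u = snd v) \<and>
     (\<forall>R\<in>syms S. \<forall>zs. set zs \<subseteq> p \<and> length zs = arity S R \<longrightarrow>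
        (map fst zs \<in> rel M R \<longleftrightarrow> map snd zs \<in> rel M R))"

lemma partial_iso_converse:
  assumes "partial_iso S M p"
  shows "partial_iso S M (p\<inverse>)"
  unfolding partial_iso_def
proof (intro conjI ballI allI impI)
  fix R zs assume *: "R \<in> syms S" "set zs \<subseteq> p\<inverse> \<and> length zs = arity S R"
  then have "set (map prod.swap zs) \<subseteq> p" by auto
  with assms * have "map fst (map prod.swap zs) \<in> rel M R \<longleftrightarrow> map snd (map prod.swap zs) \<in> rel M R"
    unfolding partial_iso_def by (metis length_map)
  then show "map fst zs \<in> rel M R \<longleftrightarrow> map snd zs \<in> rel M R" by (simp add: comp_def)
next
  show "p\<inverse> \<subseteq> univ M \<times> univ M" using assms by (auto simp: partial_iso_def)
  fix u v assume "u \<in> p\<inverse>" "v \<in> p\<inverse>"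
  then have "prod.swap u \<in> p" "prod.swap v \<in> p" by auto
  then show "fst u = fst v \<longleftrightarrow> snd u = snd v" using assms unfolding partial_iso_def by (metis fst_swap snd_swap)
qed

lemma partial_iso_iff_embedding:
  "A \<subseteq> univ M \<Longrightarrow> partial_iso S M ((\<lambda>x. (x, f x)) ` A) \<longleftrightarrow> embedding S f (submodel M A) M"
  (is "_ \<Longrightarrow> partial_iso S M (?g ` A) \<longleftrightarrow> _")
proof -
  assume A: "A \<subseteq> univ M"
  have lists: "(\<forall>zs. set zs \<subseteq> ?g ` A \<and> length zs = n \<longrightarrow> Q (map fst zs) (map snd zs)) \<longleftrightarrow>
    (\<forall>xs. set xs \<subseteq> A \<and> length xs = n \<longrightarrow> Q xs (map f xs))" (is "?L \<longleftrightarrow> ?R") for Q n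
  proof
    assume L: ?L
    show ?R
    proof (intro allI impI)
      fix xs assume "set xs \<subseteq> A \<and> length xs = n"
      then show "Q xs (map f xs)" using L[rule_format, of "map ?g xs"] by (auto simp: comp_def)
    qed
  next
    assume R: ?R
    show ?L
    proof (intro allI impI)
      fix zs assume zs: "set zs \<subseteq> ?g ` A \<and> length zs = n"
      then have "map f (map fst zs) = map snd zs" by auto
      moreover have "set (map fst zs) \<subseteq> A" using zs by auto
      ultimately show "Q (map fst zs) (map snd zs)" using R zs by (metis length_map)
    qed
  qed
  have img: "?g ` A \<subseteq> univ M \<times> univ M \<longleftrightarrow> f ` A \<subseteq> univ M" using A by auto
  have inj: "(\<forall>u\<in>?g ` A. \<forall>v\<in>?g ` A. fst u = fst v \<longleftrightarrow> snd u = snd v) \<longleftrightarrow> inj_on f A"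
    by (auto simp: inj_on_def)
  have rels: "(\<forall>zs. set zs \<subseteq> ?g ` A \<and> length zs = n \<longrightarrow> (map fst zs \<in> rel M R \<longleftrightarrow> map snd zs \<in> rel M R)) \<longleftrightarrow>
    (\<forall>xs. set xs \<subseteq> A \<and> length xs = n \<longrightarrow> (xs \<in> rel (submodel M A) R \<longleftrightarrow> map f xs \<in> rel M R))" for n R
    using lists[of n "\<lambda>x y. x \<in> rel M R \<longleftrightarrow> y \<in> rel M R"] by auto
  show ?thesis
    unfolding partial_iso_def embedding_def submodel_simps(1) img inj rels ..
qed

lemma partial_iso_graph:
  assumes "partial_iso S M p"
  obtains f where "p = (\<lambda>x. (x, f x)) ` Domain p"
proof -
  have "\<forall>x\<in>Domain p. \<exists>y. (x, y) \<in> p" by auto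
  then obtain f where f: "\<And>x. x \<in> Domain p \<Longrightarrow> (x, f x) \<in> p" by metis
  have "y = f x" if "(x, y) \<in> p" for x y
    using assms f[of x] that unfolding partial_iso_def by (metis Domain.DomainI fst_conv snd_conv)
  with f have "p = (\<lambda>x. (x, f x)) ` Domain p" by (fastforce simp: image_iff)
  with that show ?thesis .
qed

text \<open>The forth step: the domain of \<open>p\<close> with \<open>x\<close> added carries a
  finite submodel, a member of \<open>K\<close>, and richness extends to it the embedding whose
  graph is \<open>p\<close>.\<close>

lemma partial_iso_extend:
  assumes rich: "rich S K M" and sub: "\<And>A. A \<subseteq> univ M \<Longrightarrow> finite A \<Longrightarrow> submodel M A \<in> K"
    and p: "partial_iso S M p" "finite p" and x: "x \<in> univ M"
  obtains y where "partial_iso S M (insert (x, y) p)"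
proof -
  obtain f where f: "p = (\<lambda>x. (x, f x)) ` Domain p" using partial_iso_graph[OF p(1)] .
  let ?D = "Domain p"
  have D: "?D \<subseteq> univ M" "finite ?D" using p by (auto simp: partial_iso_def finite_Domain)
  have "embedding S f (submodel M ?D) M" using p(1) f partial_iso_iff_embedding[OF D(1)] by metis
  moreover have B: "submodel M (insert x ?D) \<in> K" using sub D x by simp
  moreover have "submodel (submodel M (insert x ?D)) ?D = submodel M ?D"
    by (rule submodel_submodel) auto
  ultimately obtain h where h: "embedding S h (submodel M (insert x ?D)) M" "\<And>a. a \<in> ?D \<Longrightarrow> h a = f a"
    using rich unfolding rich_def by (metis subset_insertI submodel_simps(1))
  have "p = (\<lambda>x. (x, h x)) ` ?D"
    by (subst f) (auto simp: h(2) intro!: image_cong)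
  then have "insert (x, h x) p = (\<lambda>x. (x, h x)) ` insert x ?D"
    by (metis image_insert)
  then have "partial_iso S M (insert (x, h x) p)"
    using h(1) partial_iso_iff_embedding[of "insert x ?D" M S h] D x by simp
  with that show ?thesis .
qed

lemma homogeneous_if_rich:
  fixes M :: "('r, nat) model"
  assumes rich: "rich S K M" and sub: "\<And>A. A \<subseteq> univ M \<Longrightarrow> finite A \<Longrightarrow> submodel M A \<in> K"
  shows "homogeneous S M"
  unfolding homogeneous_def
proof (intro allI impI, elim conjE)
  fix A B f assume A: "A \<subseteq> univ M" "finite A" and B: "B \<subseteq> univ M"
    and f: "isomorphism S f (submodel M A) (submodel M B)"
  define p0 where "p0 = (\<lambda>x. (x, f x)) ` A"
  have "embedding S f (submodel M A) M"
    using f B by (auto simp: isomorphism_def intro: embedding_from_submodel)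
  then have p0: "partial_iso S M p0 \<and> finite p0"
    using A by (auto simp: p0_def partial_iso_iff_embedding)
  \<comment> \<open>The universe is a set of natural numbers, so requirement \<open>n\<close>
    concerns the point \<open>n\<close> itself; it is vacuous if \<open>n\<close> is not in the
    model.\<close>
  have dense: "\<exists>q. (partial_iso S M q \<and> finite q) \<and> p \<subseteq> q \<and> (n \<in> univ M \<longrightarrow> n \<in> Domain q \<inter> Range q)"
    if p: "partial_iso S M p \<and> finite p" for n p
  proof (cases "n \<in> univ M")
    case True
    obtain y where y: "partial_iso S M (insert (n, y) p)"
      using partial_iso_extend[OF rich sub _ _ True] p by blast
    \<comment> \<open>The back step is a forth step for the converse relation, which is turned
      around again afterwards.\<close>
    obtain z where z: "partial_iso S M (insert (n, z) ((insert (n, y) p)\<inverse>))"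
      using partial_iso_extend[OF rich sub partial_iso_converse[OF y] _ True] p by auto
    have "partial_iso S M ((insert (n, z) ((insert (n, y) p)\<inverse>))\<inverse>)"
      by (rule partial_iso_converse[OF z])
    then show ?thesis using p by (intro exI[of _ "(insert (n, z) ((insert (n, y) p)\<inverse>))\<inverse>"]) auto
  qed (use p in auto)
  obtain s :: "nat \<Rightarrow> (nat \<times> nat) set" where s: "s 0 = p0"
    "\<And>n. partial_iso S M (s n) \<and> finite (s n)" "\<And>m n. m \<le> n \<Longrightarrow> s m \<subseteq> s n"
    "\<And>n. n \<in> univ M \<longrightarrow> n \<in> Domain (s (Suc n)) \<inter> Range (s (Suc n))"
    by (rule generic_chain[of "\<lambda>p. partial_iso S M p \<and> finite p" p0 "(\<subseteq>)"
          "\<lambda>n q. n \<in> univ M \<longrightarrow> n \<in> Domain q \<inter> Range q"]) (use p0 dense in blast)+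
  define r where "r = (\<Union>n. s n)"
  have r: "partial_iso S M r" unfolding partial_iso_def
  proof (intro conjI ballI allI impI)
    show "r \<subseteq> univ M \<times> univ M" using s(2) unfolding r_def partial_iso_def by blast
    fix u v assume "u \<in> r" "v \<in> r"
    then have "{u, v} \<subseteq> (\<Union>n. s n)" by (auto simp: r_def)
    then obtain n where "{u, v} \<subseteq> s n" using finite_subset_chain[where U = s and A = "{u, v}"] s(3)
      by (metis finite.emptyI finite.insertI)
    then show "fst u = fst v \<longleftrightarrow> snd u = snd v" using s(2)[of n] unfolding partial_iso_def by blast
  next
    fix R zs assume *: "R \<in> syms S" "set zs \<subseteq> r \<and> length zs = arity S R"
    then obtain n where "set zs \<subseteq> s n" using finite_subset_chain[where U = s and A = "set zs"] s(3) unfolding r_def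
      by (metis List.finite_set)
    then show "map fst zs \<in> rel M R \<longleftrightarrow> map snd zs \<in> rel M R"
      using s(2)[of n] * unfolding partial_iso_def by blast
  qed
  then have sub_r: "r \<subseteq> univ M \<times> univ M" by (simp add: partial_iso_def)
  have "x \<in> Domain r \<inter> Range r" if "x \<in> univ M" for x
    using s(4)[of x] that unfolding r_def by blast
  with sub_r have dom: "Domain r = univ M" and ran: "Range r = univ M" by auto
  obtain h where h: "r = (\<lambda>x. (x, h x)) ` univ M"
    using partial_iso_graph[OF r] unfolding dom by blast
  have "partial_iso S M ((\<lambda>x. (x, h x)) ` univ M)" using r h by simp
  then have "embedding S h (submodel M (univ M)) M"
    by (simp add: partial_iso_iff_embedding)
  then have "embedding S h M M" by (simp add: embedding_def)
  moreover have "h ` univ M = univ M" using ran unfolding h by (simp add: Range_snd image_image)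
  moreover have "h a = f a" if "a \<in> A" for a
  proof -
    have "(a, f a) \<in> r" using that s(1) by (auto simp: r_def p0_def)
    then show ?thesis unfolding h by auto
  qed
  ultimately show "\<exists>h. automorphism S h M \<and> (\<forall>a\<in>A. h a = f a)"
    by (auto simp: automorphism_def isomorphism_def)
qed

section \<open>Existence of the limit as the union of a chain\<close>

context hereditary_class
begin

text \<open>The chain starts at \<open>E\<close>, the common empty submodel; its uniqueness is an
  assumption because nullary symbols could tell empty models apart. The union is rich because every
  finite extension problem is treated at some stage where it already makes sense.\<close>

lemma limit_exists:
  assumes countable: "countable K" and ua: "union_amalgamation K" and E: "E \<in> K" "univ E = {}"
    and E_unique: "\<And>X. X \<in> K \<Longrightarrow> submodel X {} = E"
  obtains L :: "('r, nat) model" where "fraisse_limit S K L"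
proof -
  \<comment> \<open>An extension problem is a triple: a member \<open>B\<close>, a part
    \<open>A\<close> of it and a map on \<open>A\<close>. Taking the maps extensional keeps the set
    of problems countable.\<close>
  define T where "T = (SIGMA B:K. SIGMA A:Pow (univ B). A \<rightarrow>\<^sub>E (UNIV :: nat set))"
  have "countable T" unfolding T_def
  proof (intro countable_SIGMA countable)
    show "countable (Pow (univ B))" if "B \<in> K" for B
      using K_finite[OF that] by (simp add: countable_finite)
    show "countable (A \<rightarrow>\<^sub>E (UNIV :: nat set))" if "B \<in> K" "A \<in> Pow (univ B)" for A B
      using K_finite[OF that(1)] that(2) by (intro countable_PiE) (auto intro: finite_subset)
  qed
  define solved where "solved t X \<longleftrightarrow> (case t of (B, A, f) \<Rightarrow>
      B \<in> K \<and> A \<subseteq> univ B \<and> embedding S f (submodel B A) X \<longrightarrow>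
      (\<exists>h. embedding S h B X \<and> (\<forall>a\<in>A. h a = f a)))"
    for t :: "('r, nat) model \<times> nat set \<times> (nat \<Rightarrow> nat)" and X
  define below where "below X Y \<longleftrightarrow> univ X \<subseteq> univ Y \<and> submodel Y (univ X) = X" for X Y :: "('r, nat) model"
  \<comment> \<open>Via the pairing function each problem is proposed infinitely often, since
    \<open>f\<close> may become an embedding into the chain only late.\<close>
  define task where "task n = from_nat_into T (fst (prod_decode n))" for n
  have dense: "\<exists>q. q \<in> K \<and> below p q \<and> solved (task n) q" if p: "p \<in> K" for n p
  proof -
    obtain B A f where t: "task n = (B, A, f)" using prod_cases3 by blast
    show ?thesis
    proof (cases "B \<in> K \<and> A \<subseteq> univ B \<and> embedding S f (submodel B A) p")
      case True
      then have B: "B \<in> K" and A: "A \<subseteq> univ B" and f: "embedding S f (submodel B A) p" by auto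
      have g: "embedding S (\<lambda>x. x) (submodel B A) B" using A by (intro embedding_inclusion) auto
      obtain W h where "W \<in> K" "univ p \<subseteq> univ W" "submodel W (univ p) = p" "embedding S h B W"
        "\<And>z. z \<in> univ (submodel B A) \<Longrightarrow> h z = f z"
        using amalgam_over_inclusion[OF ua p B f g] by metis
      then show ?thesis by (intro exI[of _ W]) (auto simp: below_def solved_def t)
    next
      case False
      then show ?thesis using p submodel_univ[OF K_model[OF p]]
        by (intro exI[of _ p]) (auto simp: below_def solved_def t)
    qed
  qed
  obtain s :: "nat \<Rightarrow> ('r, nat) model" where s: "s 0 = E" "\<And>n. s n \<in> K"
    "\<And>m n. m \<le> n \<Longrightarrow> below (s m) (s n)" "\<And>n. solved (task n) (s (Suc n))"
  proof (rule generic_chain[of "\<lambda>X. X \<in> K" E below "\<lambda>n. solved (task n)"])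
    show "below X Z" if "below X Y" "below Y Z" for X Y Z
      using that submodel_submodel[of "univ X" "univ Y" Z] by (auto simp: below_def)
  qed (use E dense submodel_univ[OF K_model] in \<open>auto simp: below_def\<close>)
  define L where "L = \<lparr>univ = (\<Union>n. univ (s n)), rel = (\<lambda>R. \<Union>n. rel (s n) R)\<rparr>"
  have mono: "univ (s m) \<subseteq> univ (s n)" if "m \<le> n" for m n using s(3)[OF that] by (simp add: below_def)
  have rel_s: "xs \<in> rel (s m) R \<longleftrightarrow> xs \<in> rel (s n) R \<and> set xs \<subseteq> univ (s m)" if "m \<le> n" for m n xs R
    using s(3)[OF that] submodel_simps(2)[of xs "s n" "univ (s m)" R] by (simp add: below_def)
  have model_L: "is_model S L"
    using is_modelD[OF K_model[OF s(2)]] unfolding is_model_def by (fastforce simp: L_def)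
  have L_s: "submodel L (univ (s n)) = s n" for n
  proof (rule model_eqI)
    fix R xs assume *: "set xs \<subseteq> univ (submodel L (univ (s n)))"
    have "xs \<in> rel (s n) R" if "xs \<in> rel (s m) R" for m
      using that * rel_s[of m n xs R] rel_s[of n m xs R] by (cases "m \<le> n") auto
    then show "xs \<in> rel (submodel L (univ (s n))) R \<longleftrightarrow> xs \<in> rel (s n) R"
      using * by (auto simp: L_def)
  qed (auto intro: is_model_submodel model_L K_model s(2))
  have s_L: "univ (s n) \<subseteq> univ L" for n by (auto simp: L_def)
  have fin_L: "\<exists>n. A \<subseteq> univ (s n)" if "A \<subseteq> univ L" "finite A" for A
  proof -
    have "A \<subseteq> (\<Union>n. univ (s n))" using that by (simp add: L_def)
    from finite_subset_chain[OF mono that(2) this] show ?thesis by blast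
  qed
  have into_s: "\<exists>n. embedding S f X (s n)" if f: "embedding S f X L" and fin: "finite (univ X)" for X :: "('r, nat) model" and f
  proof -
    obtain n where "f ` univ X \<subseteq> univ (s n)" using fin_L[OF embeddingD(1)[OF f]] fin by blast
    from embedding_into_submodel[OF f this] L_s show ?thesis by auto
  qed
  have from_s: "embedding S f X L" if "embedding S f X (s n)" for f X n
    using embedding_from_submodel[of S f X L "univ (s n)"] that L_s s_L by simp
  have rich: "rich S K L" unfolding rich_def
  proof (intro ballI allI impI, elim conjE)
    fix B A f assume B: "B \<in> K" and A: "A \<subseteq> univ B" and f: "embedding S f (submodel B A) L"
    obtain m where m: "embedding S f (submodel B A) (s m)"
      using into_s[OF f] K_finite[OF B] A finite_subset by auto
    let ?f = "restrict f A"
    have "(B, A, ?f) \<in> T" using A B by (auto simp: T_def)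
    then obtain k where k: "from_nat_into T k = (B, A, ?f)"
      using \<open>countable T\<close> by (metis from_nat_into_to_nat_on)
    \<comment> \<open>A stage not before \<open>m\<close> at which problem \<open>k\<close> is
      proposed; it is solved in the model with index \<open>Suc n\<close>.\<close>
    define n where "n = prod_encode (k, m)"
    have "m \<le> Suc n" using le_prod_encode_2[of m k] by (simp add: n_def)
    have "embedding S (\<lambda>x. x) (s m) (s (Suc n))"
      using s(3)[OF \<open>m \<le> Suc n\<close>] by (intro embedding_inclusion) (auto simp: below_def)
    from embedding_comp[OF m this] have "embedding S ?f (submodel B A) (s (Suc n))"
      by (rule embedding_cong) auto
    moreover have "task n = (B, A, ?f)" using k by (simp add: task_def n_def)
    ultimately obtain h where "embedding S h B (s (Suc n))" "\<forall>a\<in>A. h a = f a"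
      using s(4)[of n] A B by (auto simp: solved_def)
    then show "\<exists>h. embedding S h B L \<and> (\<forall>a\<in>A. h a = f a)" using from_s by blast
  qed
  have sub: "submodel L A \<in> K" if A: "A \<subseteq> univ L" "finite A" for A
  proof -
    obtain n where n: "A \<subseteq> univ (s n)" using fin_L[OF A] ..
    have "submodel L A = submodel (s n) A" using submodel_submodel[OF n, of L] L_s by simp
    then show ?thesis using K_submodel[OF s(2) n] by simp
  qed
  have "age S L = K"
  proof (intro equalityI subsetI)
    fix X assume "X \<in> age S L"
    then obtain f where X: "is_model S X" "finite (univ X)" and f: "embedding S f X L" by (auto simp: age_def)
    show "X \<in> K" using into_s[OF f X(2)] K_embed[OF s(2) X(1)] by auto
  next
    fix X assume X: "X \<in> K"
    \<comment> \<open>Richness with the empty set as \<open>A\<close> embeds \<open>X\<close> into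
      \<open>L\<close>, starting from the first member \<open>E\<close> of the chain.\<close>
    have "embedding S (\<lambda>x. x) (submodel X {}) (s 0)"
      using E_unique[OF X] s(1) by (auto simp: embedding_def)
    then show "X \<in> age S L"
      using rich X from_s K_model[OF X] K_finite[OF X] unfolding rich_def age_def by blast
  qed
  moreover have "countable (univ L)" by simp
  ultimately have "fraisse_limit S K L"
    using model_L homogeneous_if_rich[OF rich sub] by (simp add: fraisse_limit_def)
  with that show ?thesis .
qed

end

section \<open>Diversification\<close>

lemma div_signature_simps [simp]:
  "syms (div_signature S) = Tilde ` syms S \<union> {SymP, SymC}"
  "arity (div_signature S) (Tilde R) = Suc (arity S R)"
  "arity (div_signature S) SymP = Suc 0" "arity (div_signature S) SymC = Suc 0"
  by (simp_all add: div_signature_def)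

lemma mem_parts [simp]: "x \<in> Ppart X \<longleftrightarrow> [x] \<in> rel X SymP" "x \<in> Cpart X \<longleftrightarrow> [x] \<in> rel X SymC"
  by (simp_all add: Ppart_def Cpart_def)

lemma fibre_simps [simp]:
  "univ (fibre X y) = Ppart X" "xs \<in> rel (fibre X y) R \<longleftrightarrow> xs @ [y] \<in> rel X (Tilde R)"
  by (simp_all add: fibre_def)

text \<open>The converse of taking fibres. Members of the diversification are recovered from their
  parts and fibres in this way, so amalgams and extensions amount to choosing two sets and one model
  \<open>V c\<close> for each \<open>c\<close> in \<open>C\<close>.\<close>

definition div_model :: "'a set \<Rightarrow> 'a set \<Rightarrow> ('a \<Rightarrow> ('r, 'a) model) \<Rightarrow> ('r div_sym, 'a) model" where
  "div_model P C V = \<lparr>univ = P \<union> C, rel = (\<lambda>T. case T of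
     Tilde R \<Rightarrow> {xs @ [c] | xs c. c \<in> C \<and> xs \<in> rel (V c) R}
   | SymP \<Rightarrow> {[x] | x. x \<in> P} | SymC \<Rightarrow> {[x] | x. x \<in> C})\<rparr>"

lemma div_model_simps [simp]:
  "univ (div_model P C V) = P \<union> C"
  "xs @ [c] \<in> rel (div_model P C V) (Tilde R) \<longleftrightarrow> c \<in> C \<and> xs \<in> rel (V c) R"
  "zs \<in> rel (div_model P C V) SymP \<longleftrightarrow> (\<exists>x\<in>P. zs = [x])"
  "zs \<in> rel (div_model P C V) SymC \<longleftrightarrow> (\<exists>x\<in>C. zs = [x])"
  by (auto simp: div_model_def)

lemma rel_div_model_Tilde:
  "zs \<in> rel (div_model P C V) (Tilde R) \<longleftrightarrow> (\<exists>xs c. zs = xs @ [c] \<and> c \<in> C \<and> xs \<in> rel (V c) R)"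
  by (auto simp: div_model_def)

lemma parts_div_model [simp]: "Ppart (div_model P C V) = P" "Cpart (div_model P C V) = C"
  by auto

lemma div_sym_ext:
  assumes "\<And>R. f (Tilde R) = g (Tilde R)" "f SymP = g SymP" "f SymC = g SymC"
  shows "f = g"
proof
  fix T show "f T = g T" using assms by (cases T) auto
qed

lemma div_model_cong:
  assumes "\<And>c. c \<in> C \<Longrightarrow> V c = V' c"
  shows "div_model P C V = div_model P C V'"
proof (rule model.equality)
  show "rel (div_model P C V) = rel (div_model P C V')"
    by (rule div_sym_ext) (use assms in \<open>auto simp: rel_div_model_Tilde\<close>)
qed auto

lemma submodel_div_model:
  assumes A: "A \<subseteq> P \<union> C" and V: "\<And>c R xs. c \<in> C \<Longrightarrow> xs \<in> rel (V c) R \<Longrightarrow> set xs \<subseteq> P"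
  shows "submodel (div_model P C V) A = div_model (P \<inter> A) (C \<inter> A) (\<lambda>c. submodel (V c) (P \<inter> A))"
proof (rule model.equality)
  show "rel (submodel (div_model P C V) A) = rel (div_model (P \<inter> A) (C \<inter> A) (\<lambda>c. submodel (V c) (P \<inter> A)))"
  proof (rule div_sym_ext)
    fix R
    show "rel (submodel (div_model P C V) A) (Tilde R)
      = rel (div_model (P \<inter> A) (C \<inter> A) (\<lambda>c. submodel (V c) (P \<inter> A))) (Tilde R)"
      using V by (fastforce simp: rel_div_model_Tilde)
  qed auto
qed (use A in auto)

lemma div_model_of_parts:
  assumes "Ppart X \<union> Cpart X = univ X" "is_model (div_signature S) X"
    and tilde: "\<And>R. R \<in> syms S \<Longrightarrow> rel X (Tilde R) \<subseteq>
       {xs @ [y] | xs y. set xs \<subseteq> Ppart X \<and> length xs = arity S R \<and> y \<in> Cpart X}"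
  shows "div_model (Ppart X) (Cpart X) (fibre X) = X"
proof (rule model.equality)
  note D = is_modelD[OF assms(2)]
  show "rel (div_model (Ppart X) (Cpart X) (fibre X)) = rel X"
  proof (rule div_sym_ext)
    fix R
    have "zs \<in> rel (div_model (Ppart X) (Cpart X) (fibre X)) (Tilde R)" if zs: "zs \<in> rel X (Tilde R)" for zs
      using tilde[of R] D(1)[OF zs] zs by (auto simp: rel_div_model_Tilde)
    then show "rel (div_model (Ppart X) (Cpart X) (fibre X)) (Tilde R) = rel X (Tilde R)"
      by (auto simp: rel_div_model_Tilde)
  qed (use D(3) in \<open>fastforce simp: length_Suc_conv\<close>)+
qed (use assms(1) in auto)

text \<open>The hypotheses in the form in which they are used. \<open>F_nonempty\<close> excludes
  only the class whose sole universe is empty; for an empty \<open>F\<close> the diversification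
  consists of the finite models without C-part.\<close>

locale div_class = hereditary_class S F for S :: "'r signature" and F +
  assumes F_union: "union_amalgamation F" and F_joint: "joint_embedding S F"
    and F_nonempty: "univ ` F \<noteq> {{}}" and F_countable: "countable F"
begin

abbreviation "D \<equiv> div_signature S"
abbreviation "DF \<equiv> diversification S F"

lemma DF_model: "X \<in> DF \<Longrightarrow> is_model D X"
  and DF_finite: "X \<in> DF \<Longrightarrow> finite (univ X)"
  and DF_univ: "X \<in> DF \<Longrightarrow> univ X = Ppart X \<union> Cpart X"
  and DF_disjoint: "X \<in> DF \<Longrightarrow> Ppart X \<inter> Cpart X = {}"
  and DF_fibre: "X \<in> DF \<Longrightarrow> y \<in> Cpart X \<Longrightarrow> fibre X y \<in> F"
  by (auto simp: diversification_def)

lemma DF_div_model: "X \<in> DF \<Longrightarrow> div_model (Ppart X) (Cpart X) (fibre X) = X"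
  by (rule div_model_of_parts) (auto simp: diversification_def)

lemma div_model_in_DF:
  assumes "finite P" "finite C" "P \<inter> C = {}" and V: "\<And>c. c \<in> C \<Longrightarrow> V c \<in> F \<and> univ (V c) = P"
  shows "div_model P C V \<in> DF"
proof -
  have VD: "R \<in> syms S" "set xs \<subseteq> P" "length xs = arity S R" if "c \<in> C" "xs \<in> rel (V c) R" for c xs R
    using is_modelD[OF K_model that(2)] V[OF that(1)] by auto
  have "is_model D (div_model P C V)"
    unfolding is_model_def
  proof (intro conjI ballI allI impI)
    fix T assume "T \<in> syms D"
    then show "rel (div_model P C V) T \<subseteq> {xs. set xs \<subseteq> univ (div_model P C V) \<and> length xs = arity D T}"
      using VD by (cases T) (fastforce simp: rel_div_model_Tilde)+
  next
    fix T assume "T \<notin> syms D"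
    then show "rel (div_model P C V) T = {}"
      using VD by (cases T) (auto simp: rel_div_model_Tilde)
  qed
  moreover have "fibre (div_model P C V) c = V c" if "c \<in> C" for c
    using V[OF that] that by (intro model.equality ext) auto
  ultimately show ?thesis
    using assms VD by (auto simp: diversification_def rel_div_model_Tilde simp del: mem_parts)
qed

lemma fibre_rel:
  assumes "X \<in> DF" "y \<in> Cpart X" "xs \<in> rel (fibre X y) R"
  shows "set xs \<subseteq> Ppart X"
  using is_modelD(2)[OF K_model[OF DF_fibre[OF assms(1,2)]] assms(3)] by simp

lemma submodel_DF:
  assumes X: "X \<in> DF" and A: "A \<subseteq> univ X"
  shows "submodel X A = div_model (Ppart X \<inter> A) (Cpart X \<inter> A) (\<lambda>c. submodel (fibre X c) (Ppart X \<inter> A))"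
proof -
  have "submodel (div_model (Ppart X) (Cpart X) (fibre X)) A =
    div_model (Ppart X \<inter> A) (Cpart X \<inter> A) (\<lambda>c. submodel (fibre X c) (Ppart X \<inter> A))"
    by (rule submodel_div_model) (use A DF_univ[OF X] fibre_rel[OF X] in blast)+
  then show ?thesis by (simp only: DF_div_model[OF X])
qed

lemma DF_submodel:
  assumes X: "X \<in> DF" and A: "A \<subseteq> univ X"
  shows "submodel X A \<in> DF"
proof -
  have fin: "finite (Ppart X)" "finite (Cpart X)"
    using DF_finite[OF X] DF_univ[OF X] by simp_all
  show ?thesis unfolding submodel_DF[OF X A]
    by (rule div_model_in_DF)
      (use fin DF_disjoint[OF X] DF_fibre[OF X] K_submodel in \<open>auto simp del: mem_parts\<close>)
qed

text \<open>An isomorphism respects \<open>SymP\<close> and \<open>SymC\<close>, hence carries parts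
  to parts; it respects each \<open>Tilde R\<close>, hence restricts to an isomorphism from the
  fibre over \<open>c\<close> to the fibre over \<open>f c\<close>.\<close>

lemma DF_isomorphic:
  assumes X: "X \<in> DF" and Y: "is_model D Y" and f: "isomorphism D f X Y"
  shows "Y \<in> DF"
proof -
  have e: "embedding D f X Y" and im: "univ Y = f ` univ X" using f by (auto simp: isomorphism_def)
  have P: "[f x] \<in> rel Y SymP \<longleftrightarrow> [x] \<in> rel X SymP" and C: "[f x] \<in> rel Y SymC \<longleftrightarrow> [x] \<in> rel X SymC"
    if "x \<in> univ X" for x
    using embeddingD(3)[OF e, of SymP "[x]"] embeddingD(3)[OF e, of SymC "[x]"] that by simp_all
  have PX: "Ppart X \<subseteq> univ X" and CX: "Cpart X \<subseteq> univ X" using DF_univ[OF X] by blast+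
  have PY: "Ppart Y = f ` Ppart X"
  proof
    show "Ppart Y \<subseteq> f ` Ppart X"
    proof
      fix y assume y: "y \<in> Ppart Y"
      then have "y \<in> univ Y" using is_modelD(2)[OF Y, of "[y]" SymP] by simp
      then show "y \<in> f ` Ppart X" using P y im by auto
    qed
    show "f ` Ppart X \<subseteq> Ppart Y" using P PX by auto
  qed
  have CY: "Cpart Y = f ` Cpart X"
  proof
    show "Cpart Y \<subseteq> f ` Cpart X"
    proof
      fix y assume y: "y \<in> Cpart Y"
      then have "y \<in> univ Y" using is_modelD(2)[OF Y, of "[y]" SymC] by simp
      then show "y \<in> f ` Cpart X" using C y im by auto
    qed
    show "f ` Cpart X \<subseteq> Cpart Y" using C CX by auto
  qed
  have tilde: "rel Y (Tilde R) \<subseteq> {xs @ [y] | xs y. set xs \<subseteq> Ppart Y \<and> length xs = arity S R \<and> y \<in> Cpart Y}"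
    if R: "R \<in> syms S" for R
  proof
    fix ys assume ys: "ys \<in> rel Y (Tilde R)"
    note YD = is_modelD[OF Y ys]
    have "ys \<in> lists (f ` univ X)" using YD(2) im by auto
    then obtain zs where zs: "set zs \<subseteq> univ X" "ys = map f zs" by (auto simp: lists_image)
    then have "zs \<in> rel X (Tilde R)" using embeddingD(3)[OF e YD(1) zs(1)] YD(3) ys by simp
    then obtain xs y where xs: "zs = xs @ [y]" "set xs \<subseteq> Ppart X" "length xs = arity S R" "y \<in> Cpart X"
      using X R unfolding diversification_def by blast
    moreover from this have "set (map f xs) \<subseteq> Ppart Y" "f y \<in> Cpart Y" unfolding PY CY by auto
    ultimately show "ys \<in> {xs @ [y] | xs y. set xs \<subseteq> Ppart Y \<and> length xs = arity S R \<and> y \<in> Cpart Y}"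
      using zs(2) by (intro CollectI exI[of _ "map f xs"] exI[of _ "f y"]) (simp del: mem_parts)
  qed
  have fibre: "fibre Y (f c) \<in> F" if c: "c \<in> Cpart X" for c
  proof -
    have "embedding S f (fibre X c) (fibre Y (f c))"
      unfolding embedding_def fibre_simps(1)
    proof (intro conjI ballI allI impI)
      show "f ` Ppart X \<subseteq> Ppart Y" using PY by simp
      show "inj_on f (Ppart X)" using embeddingD(2)[OF e] PX by (rule inj_on_subset)
      fix R xs assume R: "R \<in> syms S" and xs: "set xs \<subseteq> Ppart X \<and> length xs = arity S R"
      have "set (xs @ [c]) \<subseteq> univ X" using xs c PX CX by (auto simp del: mem_parts)
      then have "map f (xs @ [c]) \<in> rel Y (Tilde R) \<longleftrightarrow> xs @ [c] \<in> rel X (Tilde R)"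
        by (rule embeddingD(3)[OF e, rotated]) (use R xs in auto)
      then show "xs \<in> rel (fibre X c) R \<longleftrightarrow> map f xs \<in> rel (fibre Y (f c)) R" by simp
    qed
    then have "isomorphic S (fibre X c) (fibre Y (f c))"
      unfolding isomorphic_def isomorphism_def using PY by auto
    moreover have "is_model S (fibre Y (f c))"
      unfolding is_model_def fibre_simps(1)
    proof (intro conjI ballI allI impI)
      fix R assume "R \<in> syms S"
      then show "rel (fibre Y (f c)) R \<subseteq> {xs. set xs \<subseteq> Ppart Y \<and> length xs = arity S R}"
        using tilde by (fastforce simp del: mem_parts)
    next
      fix R assume "R \<notin> syms S"
      then show "rel (fibre Y (f c)) R = {}" using is_modelD(1)[OF Y] by fastforce
    qed
    ultimately show ?thesis using fmc DF_fibre[OF X c] unfolding finite_model_class_def by blast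
  qed
  have disj: "Ppart Y \<inter> Cpart Y = {}"
    unfolding PY CY using DF_disjoint[OF X] embeddingD(2)[OF e] PX CX
    by (metis image_empty inj_on_image_Int)
  have "Ppart Y \<union> Cpart Y = univ Y" unfolding PY CY im using DF_univ[OF X] by (simp add: image_Un)
  moreover have "finite (univ Y)" using im DF_finite[OF X] by simp
  ultimately show ?thesis
    using Y disj tilde fibre by (auto simp: diversification_def CY simp del: mem_parts)
qed

sublocale DF: hereditary_class D DF
proof
  show "finite_model_class D DF"
    unfolding finite_model_class_def isomorphic_def
    using DF_model DF_finite DF_isomorphic by blast
  show "hereditary DF" using DF_submodel by (simp add: hereditary_def)
qed

text \<open>Empty models differ at most in the nullary symbols, and on these both \<open>X\<close>
  and \<open>Y\<close> agree with a joint extension \<open>W\<close>.\<close>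

lemma F_empty_unique:
  assumes "X \<in> F" "Y \<in> F"
  shows "submodel X {} = submodel Y {}"
proof -
  obtain W f g where "W \<in> F" and f: "embedding S f X W" and g: "embedding S g Y W"
    using F_joint assms unfolding joint_embedding_def by blast
  show ?thesis
  proof (rule model_eqI)
    fix R xs assume "R \<in> syms S" "set xs \<subseteq> univ (submodel X {})" "length xs = arity S R"
    then show "xs \<in> rel (submodel X {}) R \<longleftrightarrow> xs \<in> rel (submodel Y {}) R"
      using embeddingD(3)[OF f, of R "[]"] embeddingD(3)[OF g, of R "[]"] by auto
  qed (use assms K_model in \<open>auto intro: is_model_submodel\<close>)
qed

text \<open>New points are added one at a time, each by amalgamation with a one-point model over the
  empty model.\<close>

lemma F_extend:
  assumes X: "X \<in> F" and "finite Q"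
  shows "\<exists>W\<in>F. univ W = univ X \<union> Q \<and> submodel W (univ X) = X"
  using \<open>finite Q\<close>
proof (induction Q rule: finite_induct)
  case empty
  then show ?case using X submodel_univ[OF K_model[OF X]] by (intro bexI[of _ X]) auto
next
  case (insert b Q)
  then obtain W where W: "W \<in> F" "univ W = univ X \<union> Q" "submodel W (univ X) = X" by blast
  show ?case
  proof (cases "b \<in> univ W")
    case True
    with W show ?thesis by (intro bexI[of _ W]) auto
  next
    case False
    obtain N p where N: "N \<in> F" "p \<in> univ N" using F_nonempty X by fastforce
    \<comment> \<open>A one-point model with \<open>b\<close> as its point: the submodel of
      \<open>N\<close> at \<open>p\<close>, renamed by the constant map.\<close>
    define Y where "Y = pullback S (\<lambda>_. p) {b} N"
    have Y: "Y \<in> F" unfolding Y_def by (rule K_pullback[OF N(1)]) (use N in auto)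
    \<comment> \<open>The universes are disjoint, so agreement concerns the empty submodels
      alone.\<close>
    have "agree W Y" using False F_empty_unique[OF W(1) Y] by (simp add: agree_def Y_def)
    then obtain W' where W': "W' \<in> F" "univ W' = univ W \<union> univ Y" "submodel W' (univ W) = W"
      using F_union W(1) Y unfolding union_amalgamation_def by blast
    have "submodel W' (univ X) = X"
      using submodel_submodel[of "univ X" "univ W" W'] W' W by auto
    with W' W show ?thesis by (intro bexI[of _ W']) (auto simp: Y_def)
  qed
qed

text \<open>Being an induced submodel is checked fibre by fibre; both amalgamation and the
  equivariant extension rely on this criterion.\<close>

lemma submodel_div_model_eq:
  assumes X: "X \<in> DF" and P: "P \<inter> univ X = Ppart X" and C: "C \<inter> univ X = Cpart X"
    and V: "\<And>c. c \<in> C \<Longrightarrow> V c \<in> F \<and> univ (V c) = P"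
    and VX: "\<And>c. c \<in> Cpart X \<Longrightarrow> submodel (V c) (Ppart X) = fibre X c"
  shows "submodel (div_model P C V) (univ X) = X"
proof -
  have "submodel (div_model P C V) (univ X) = div_model (Ppart X) (Cpart X) (\<lambda>c. submodel (V c) (Ppart X))"
    unfolding P[symmetric] C[symmetric]
  proof (rule submodel_div_model)
    show "univ X \<subseteq> P \<union> C" using DF_univ[OF X] P C by blast
    show "set xs \<subseteq> P" if "c \<in> C" "xs \<in> rel (V c) R" for c R xs
      using is_modelD(2)[OF K_model that(2)] V[OF that(1)] by auto
  qed
  also have "\<dots> = div_model (Ppart X) (Cpart X) (fibre X)"
    by (rule div_model_cong[OF VX])
  finally show ?thesis using DF_div_model[OF X] by simp
qed

lemma DF_union_amalgamation: "union_amalgamation DF"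
  unfolding union_amalgamation_def
proof (intro ballI impI)
  fix X Y assume X: "X \<in> DF" and Y: "Y \<in> DF" and "agree X Y"
  let ?I = "univ X \<inter> univ Y"
  let ?P = "Ppart X \<union> Ppart Y" and ?C = "Cpart X \<union> Cpart Y"
  have eq: "submodel X ?I = submodel Y ?I" using \<open>agree X Y\<close> by (simp add: agree_def)
  have tr: "zs \<in> rel X T \<longleftrightarrow> zs \<in> rel Y T" if "set zs \<subseteq> ?I" for zs T
    using submodel_simps(2)[of zs X ?I T] submodel_simps(2)[of zs Y ?I T] that eq by simp
  have PI: "x \<in> Ppart X \<longleftrightarrow> x \<in> Ppart Y" and CI: "x \<in> Cpart X \<longleftrightarrow> x \<in> Cpart Y"
    if "x \<in> univ X" "x \<in> univ Y" for x
    using tr[of "[x]"] that by simp_all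
  note parts = DF_univ[OF X] DF_univ[OF Y] DF_disjoint[OF X] DF_disjoint[OF Y]
  have fin: "finite ?P" "finite ?C" using DF_finite[OF X] DF_finite[OF Y] parts by simp_all
  \<comment> \<open>A point in the P-part of one model and the C-part of the other would lie in the
    overlap, where the two models agree.\<close>
  have disj: "?P \<inter> ?C = {}" using parts PI CI by blast
  \<comment> \<open>Fibres over different \<open>c\<close> are chosen independently; all that ties
    them together is the prescribed universe \<open>?P\<close>.\<close>
  have "\<exists>V. V \<in> F \<and> univ V = ?P \<and> (c \<in> Cpart X \<longrightarrow> submodel V (Ppart X) = fibre X c) \<and>
      (c \<in> Cpart Y \<longrightarrow> submodel V (Ppart Y) = fibre Y c)" if c: "c \<in> ?C" for c
  proof -
    consider "c \<in> Cpart X" "c \<in> Cpart Y" | "c \<in> Cpart X" "c \<notin> Cpart Y" | "c \<notin> Cpart X" "c \<in> Cpart Y"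
      using c by blast
    then show ?thesis
    proof cases
      case 1
      have "agree (fibre X c) (fibre Y c)"
        unfolding agree_def fibre_simps(1)
      proof (rule model.equality)
        have "xs @ [c] \<in> rel X (Tilde R) \<longleftrightarrow> xs @ [c] \<in> rel Y (Tilde R)"
          if "set xs \<subseteq> Ppart X \<inter> Ppart Y" for xs R
          by (rule tr) (use that 1 parts(1,2) in \<open>auto simp del: mem_parts\<close>)
        then show "rel (submodel (fibre X c) (Ppart X \<inter> Ppart Y)) = rel (submodel (fibre Y c) (Ppart X \<inter> Ppart Y))"
          by (intro ext) (auto simp del: mem_parts)
      qed auto
      then obtain W where "W \<in> F" "univ W = ?P" "submodel W (Ppart X) = fibre X c" "submodel W (Ppart Y) = fibre Y c"
        using F_union DF_fibre[OF X 1(1)] DF_fibre[OF Y 1(2)] unfolding union_amalgamation_def by fastforce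
      then show ?thesis by blast
    next
      case 2
      then show ?thesis using F_extend[OF DF_fibre[OF X 2(1)], of "Ppart Y"] fin by auto
    next
      case 3
      then show ?thesis using F_extend[OF DF_fibre[OF Y 3(2)], of "Ppart X"] fin by (auto simp: Un_commute)
    qed
  qed
  then obtain V where V: "\<And>c. c \<in> ?C \<Longrightarrow> V c \<in> F \<and> univ (V c) = ?P"
    and VX: "\<And>c. c \<in> Cpart X \<Longrightarrow> submodel (V c) (Ppart X) = fibre X c"
    and VY: "\<And>c. c \<in> Cpart Y \<Longrightarrow> submodel (V c) (Ppart Y) = fibre Y c"
    by (metis UnCI)
  let ?W = "div_model ?P ?C V"
  have "?W \<in> DF" by (rule div_model_in_DF[OF fin disj V])
  moreover have "submodel ?W (univ X) = X"
    by (rule submodel_div_model_eq[OF X _ _ V VX]) (use parts PI CI in blast)+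
  moreover have "submodel ?W (univ Y) = Y"
    by (rule submodel_div_model_eq[OF Y _ _ V VY]) (use parts PI CI in blast)+
  moreover have "univ ?W = univ X \<union> univ Y" using parts by auto
  ultimately show "\<exists>W\<in>DF. univ W = univ X \<union> univ Y \<and> submodel W (univ X) = X \<and> submodel W (univ Y) = Y"
    by blast
qed

lemma empty_in_DF: "div_model {} {} V \<in> DF"
  by (rule div_model_in_DF) auto

text \<open>Every symbol of the diversified signature has positive arity, so there is just one empty
  model, whatever \<open>V\<close> is.\<close>

lemma submodel_DF_empty:
  assumes "X \<in> DF"
  shows "submodel X {} = div_model {} {} V"
  using submodel_DF[OF assms, of "{}"] div_model_cong[of "{}" "\<lambda>c. submodel (fibre X c) {}" V "{}"] by simp

text \<open>Amalgamation over the empty submodel: no tuple of positive length has all its entries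
  there, so the same \<open>?Z\<close> embeds into \<open>Y\<close> as well.\<close>

lemma DF_joint_embedding: "joint_embedding D DF"
  unfolding joint_embedding_def
proof (intro ballI)
  fix X Y assume X: "X \<in> DF" and Y: "Y \<in> DF"
  let ?Z = "submodel X {}"
  have "embedding D (\<lambda>x. x) ?Z X" by (intro embedding_inclusion) auto
  moreover have "embedding D (\<lambda>x. x) ?Z Y" by (auto simp: embedding_def)
  moreover have "?Z \<in> DF" by (rule DF_submodel[OF X]) simp
  ultimately show "\<exists>W\<in>DF. (\<exists>f. embedding D f X W) \<and> (\<exists>g. embedding D g Y W)"
    using DF.amalgamation_if_union_amalgamation[OF DF_union_amalgamation] X Y
    unfolding amalgamation_def by metis
qed

text \<open>A member is determined by two finite sets of naturals and a map from the second one to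
  the countable class \<open>F\<close>.\<close>

lemma DF_countable: "countable DF"
proof (rule countable_subset)
  let ?A = "\<Union>P\<in>Collect finite. \<Union>C\<in>Collect finite. div_model P C ` (C \<rightarrow>\<^sub>E F)"
  show "DF \<subseteq> ?A"
  proof
    fix X assume X: "X \<in> DF"
    let ?V = "restrict (fibre X) (Cpart X)"
    have "X = div_model (Ppart X) (Cpart X) ?V"
      using DF_div_model[OF X] div_model_cong[of "Cpart X" "fibre X" ?V] by simp
    moreover have "?V \<in> Cpart X \<rightarrow>\<^sub>E F" using DF_fibre[OF X] by auto
    moreover have "finite (Ppart X)" "finite (Cpart X)"
      using DF_finite[OF X] DF_univ[OF X] by simp_all
    ultimately show "X \<in> ?A" by (metis (mono_tags, lifting) UN_I image_eqI mem_Collect_eq)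
  qed
  show "countable ?A"
    by (intro countable_UN countable_Collect_finite countable_image countable_PiE F_countable) auto
qed

lemma DF_fraisse: "fraisse_class D DF"
  unfolding fraisse_class_def
  using DF.fmc DF.hered DF_joint_embedding countably_many_iso_types_if_countable[OF DF_countable]
    DF.amalgamation_if_union_amalgamation[OF DF_union_amalgamation] by blast

lemma DF_limit_exists: "\<exists>L :: ('r div_sym, nat) model. fraisse_limit D DF L"
  using DF.limit_exists[OF DF_countable DF_union_amalgamation empty_in_DF, of undefined]
    submodel_DF_empty by (metis Un_empty div_model_simps(1))

end

section \<open>Free actions\<close>

text \<open>The set \<open>A\<close> need not be the whole universe: finite sets with such an action
  are the approximations from which the action on the limit is built. Nothing is asked of
  \<open>act\<close> off \<open>A\<close>.\<close>

definition free_action_on ::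
    "('g, 'm) monoid_scheme \<Rightarrow> 'r signature \<Rightarrow> ('r, 'a) model \<Rightarrow> 'a set \<Rightarrow> ('g \<Rightarrow> 'a \<Rightarrow> 'a) \<Rightarrow> bool" where
  "free_action_on G S M A act \<longleftrightarrow>
     (\<forall>g\<in>carrier G. \<forall>a\<in>A. act g a \<in> A) \<and>
     (\<forall>g\<in>carrier G. \<forall>h\<in>carrier G. \<forall>a\<in>A. act (g \<otimes>\<^bsub>G\<^esub> h) a = act g (act h a)) \<and>
     (\<forall>a\<in>A. act \<one>\<^bsub>G\<^esub> a = a) \<and>
     (\<forall>g\<in>carrier G. \<forall>a\<in>A. act g a = a \<longrightarrow> g = \<one>\<^bsub>G\<^esub>) \<and>
     (\<forall>g\<in>carrier G. \<forall>R\<in>syms S. \<forall>xs. set xs \<subseteq> A \<and> length xs = arity S R \<longrightarrow>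
        (map (act g) xs \<in> rel M R \<longleftrightarrow> xs \<in> rel M R))"

lemma free_action_onD:
  assumes "free_action_on G S M A act"
  shows "g \<in> carrier G \<Longrightarrow> a \<in> A \<Longrightarrow> act g a \<in> A"
    "g \<in> carrier G \<Longrightarrow> h \<in> carrier G \<Longrightarrow> a \<in> A \<Longrightarrow> act (g \<otimes>\<^bsub>G\<^esub> h) a = act g (act h a)"
    "a \<in> A \<Longrightarrow> act \<one>\<^bsub>G\<^esub> a = a"
    "g \<in> carrier G \<Longrightarrow> a \<in> A \<Longrightarrow> act g a = a \<Longrightarrow> g = \<one>\<^bsub>G\<^esub>"
    "g \<in> carrier G \<Longrightarrow> R \<in> syms S \<Longrightarrow> set xs \<subseteq> A \<Longrightarrow> length xs = arity S R \<Longrightarrow>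
      map (act g) xs \<in> rel M R \<longleftrightarrow> xs \<in> rel M R"
  using assms unfolding free_action_on_def by blast+

lemma free_action_on_cong:
  assumes act: "free_action_on G S M A act" and eq: "\<And>g x. g \<in> carrier G \<Longrightarrow> x \<in> A \<Longrightarrow> act' g x = act g x"
    and one: "\<one>\<^bsub>G\<^esub> \<in> carrier G" and mult: "\<And>g h. g \<in> carrier G \<Longrightarrow> h \<in> carrier G \<Longrightarrow> g \<otimes>\<^bsub>G\<^esub> h \<in> carrier G"
  shows "free_action_on G S M A act'"
proof -
  have "map (act' g) xs = map (act g) xs" if "g \<in> carrier G" "set xs \<subseteq> A" for g xs
    using that eq by auto
  then show ?thesis
    using act eq one mult unfolding free_action_on_def by (auto simp del: map_eq_conv)
qed

lemma free_action_on_submodel: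
  assumes "A \<subseteq> C"
  shows "free_action_on G S (submodel M C) A act \<longleftrightarrow> free_action_on G S M A act"
proof -
  have "set xs \<subseteq> C" "set (map (act g) xs) \<subseteq> C"
    if "\<forall>g\<in>carrier G. \<forall>a\<in>A. act g a \<in> A" "g \<in> carrier G" "set xs \<subseteq> A" for g xs
    using that assms by auto
  then show ?thesis unfolding free_action_on_def submodel_simps by blast
qed

text \<open>The action conjugated by \<open>h\<close>. This carries an action on an abstract
  extension into the limit, and an action on a copy of the limit to the limit itself.\<close>

lemma free_action_on_image:
  assumes act: "free_action_on G S B (univ B) act" and h: "embedding S h B N"
  shows "free_action_on G S N (h ` univ B) (\<lambda>g y. h (act g (inv_into (univ B) h y)))"
proof -
  let ?i = "inv_into (univ B) h"
  have ih: "?i (h x) = x" if "x \<in> univ B" for x using that embeddingD(2)[OF h] by simp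
  note D = free_action_onD[OF act]
  show ?thesis
    unfolding free_action_on_def
  proof (intro conjI ballI allI impI)
    fix g a assume g: "g \<in> carrier G" and a: "a \<in> h ` univ B" and fixed: "h (act g (?i a)) = a"
    then obtain x where x: "x \<in> univ B" "a = h x" by auto
    then have "h (act g x) = h x" using fixed ih by simp
    then have "act g x = x" using x D(1)[OF g] embeddingD(2)[OF h] by (simp add: inj_on_eq_iff)
    then show "g = \<one>\<^bsub>G\<^esub>" by (rule D(4)[OF g x(1)])
  next
    fix g R ys assume g: "g \<in> carrier G" and R: "R \<in> syms S"
      and ys: "set ys \<subseteq> h ` univ B \<and> length ys = arity S R"
    then have "ys \<in> lists (h ` univ B)" by auto
    then obtain xs where xs: "set xs \<subseteq> univ B" "ys = map h xs" by (auto simp: lists_image)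
    have "map (\<lambda>y. h (act g (?i y))) ys = map h (map (act g) xs)" using xs ih by auto
    moreover have "set (map (act g) xs) \<subseteq> univ B" using xs D(1)[OF g] by auto
    ultimately show "map (\<lambda>y. h (act g (?i y))) ys \<in> rel N R \<longleftrightarrow> ys \<in> rel N R"
      using D(5)[OF g R xs(1)] embeddingD(3)[OF h R] xs ys by (simp del: map_map)
  qed (use D ih in auto)
qed

lemma acts_freely_if_free_action_on:
  assumes G: "group G" and act: "free_action_on G S M (univ M) act"
  shows "acts_freely G S M"
proof -
  interpret group G by (rule G)
  note D = free_action_onD[OF act]
  \<comment> \<open>Elements of \<open>BijGroup\<close> are extensional functions, hence the
    restriction.\<close>
  define \<phi> where "\<phi> g = restrict (act g) (univ M)" for g
  have inv: "act (inv\<^bsub>G\<^esub> g) (act g x) = x" "act g (act (inv\<^bsub>G\<^esub> g) x) = x"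
    if "g \<in> carrier G" "x \<in> univ M" for g x
    using D(2)[of "inv\<^bsub>G\<^esub> g" g x] D(2)[of g "inv\<^bsub>G\<^esub> g" x] D(3)[of x] that by auto
  have bij: "bij_betw (act g) (univ M) (univ M)" if g: "g \<in> carrier G" for g
    by (rule bij_betwI[where g = "act (inv\<^bsub>G\<^esub> g)"]) (use g D(1) inv in auto)
  have Bij: "\<phi> g \<in> Bij (univ M)" if "g \<in> carrier G" for g
    using bij[OF that] unfolding \<phi>_def Bij_def by (simp add: bij_betw_restrict_eq)
  have "group_action G (univ M) \<phi>"
    unfolding group_action_def group_hom_def group_hom_axioms_def
  proof (intro conjI G group_BijGroup homI)
    show "\<phi> g \<in> carrier (BijGroup (univ M))" if "g \<in> carrier G" for g
      using Bij[OF that] by (simp add: BijGroup_def)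
    show "\<phi> (g \<otimes>\<^bsub>G\<^esub> h) = \<phi> g \<otimes>\<^bsub>BijGroup (univ M)\<^esub> \<phi> h" if "g \<in> carrier G" "h \<in> carrier G" for g h
      using Bij that D(1)[OF that(2)] D(2)[OF that] by (auto simp: BijGroup_def \<phi>_def compose_def)
  qed
  moreover have "automorphism S (\<phi> g) M" if g: "g \<in> carrier G" for g
  proof -
    have "embedding S (act g) M M"
      using bij[OF g] D(5)[OF g] by (auto simp: embedding_def bij_betw_def)
    then have "embedding S (\<phi> g) M M" by (rule embedding_cong) (simp add: \<phi>_def)
    then show ?thesis
      using bij[OF g] by (simp add: automorphism_def isomorphism_def \<phi>_def bij_betw_def)
  qed
  moreover have "g = \<one>\<^bsub>G\<^esub>" if "g \<in> carrier G" "x \<in> univ M" "\<phi> g x = x" for g x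
    using D(4)[OF that(1,2)] that by (simp add: \<phi>_def)
  ultimately show ?thesis unfolding acts_freely_def by blast
qed

section \<open>Extension of a free action by one orbit\<close>

context hereditary_class
begin

text \<open>In the induction \<open>W\<close> is amalgamated with \<open>E i\<close> over
  \<open>Z\<close>. The new point \<open>v i\<close> is not in \<open>W\<close>, so the two overlap
  exactly in \<open>B\<close>; and as \<open>W\<close> stays a submodel, the extensions already
  realised remain so.\<close>

lemma amalgam_of_one_point_extensions:
  assumes ua: "union_amalgamation K" and J: "finite J" and Z: "Z \<in> K" "univ Z = B"
    and v: "inj_on v J" "\<And>j. j \<in> J \<Longrightarrow> v j \<notin> B"
    and E: "\<And>j. j \<in> J \<Longrightarrow> E j \<in> K" "\<And>j. j \<in> J \<Longrightarrow> univ (E j) = insert (v j) B"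
    and EZ: "\<And>j. j \<in> J \<Longrightarrow> submodel (E j) B = Z"
  shows "\<exists>W\<in>K. univ W = B \<union> v ` J \<and> submodel W B = Z \<and> (\<forall>j\<in>J. submodel W (insert (v j) B) = E j)"
  using J v E EZ
proof (induction J rule: finite_induct)
  case empty
  then show ?case using Z submodel_univ[OF K_model[OF Z(1)]] by (intro bexI[of _ Z]) auto
next
  case (insert i J)
  then obtain W where W: "W \<in> K" "univ W = B \<union> v ` J" "submodel W B = Z"
    "\<And>j. j \<in> J \<Longrightarrow> submodel W (Set.insert (v j) B) = E j"
    by (auto simp: inj_on_insert)
  have i: "E i \<in> K" "univ (E i) = Set.insert (v i) B" "submodel (E i) B = Z" "v i \<notin> B \<union> v ` J"
    using insert.prems insert.hyps by (auto simp: inj_on_insert)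
  have "univ W \<inter> univ (E i) = B" using i W(2) by auto
  then have "agree W (E i)" using i(3) W(3) by (simp add: agree_def)
  then obtain W' where W': "W' \<in> K" "univ W' = univ W \<union> univ (E i)" "submodel W' (univ W) = W"
    "submodel W' (univ (E i)) = E i"
    using ua W(1) i(1) unfolding union_amalgamation_def by blast
  have sub: "submodel W' A = submodel W A" if "A \<subseteq> univ W" for A
    using submodel_submodel[OF that, of W'] W'(3) by simp
  have "submodel W' B = Z" using sub[of B] W by auto
  moreover have "submodel W' (Set.insert (v j) B) = E j" if "j \<in> J" for j
    using sub[of "Set.insert (v j) B"] W(2) W(4)[OF that] that by auto
  moreover have "univ W' = B \<union> v ` Set.insert i J" using W' W(2) i(2) by auto
  ultimately show ?case using W'(1,4) i(2) by (intro bexI[of _ W']) auto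
qed

end

text \<open>One step of the construction of a free action: \<open>act\<close> is defined on \<open>A\<close>, and the new point
  \<open>m\<close> gets a regular orbit, with \<open>\<nu> g\<close> the image of \<open>m\<close> under \<open>g\<close>.\<close>

locale free_extension = div_class S F + group G for S :: "'r signature" and F and G :: "'g monoid" (structure) +
  fixes X :: "('r div_sym, nat) model" and A :: "nat set" and m :: nat and act :: "'g \<Rightarrow> nat \<Rightarrow> nat"
    and \<nu> :: "'g \<Rightarrow> nat"
  assumes finG: "finite (carrier G)" and X: "X \<in> DF" and univX: "univ X = insert m A" and mA: "m \<notin> A"
    and action: "free_action_on G D X A act"
    and \<nu>_inj: "inj_on \<nu> (carrier G)" and \<nu>_new: "g \<in> carrier G \<Longrightarrow> \<nu> g \<notin> A" and \<nu>_one: "\<nu> \<one> = m"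
begin

text \<open>Off \<open>A\<close> this is left multiplication, with the elements of the group named
  by \<nu>; hence the new orbit is regular.\<close>

definition "act' g x = (if x \<in> A then act g x else \<nu> (g \<otimes> inv_into (carrier G) \<nu> x))"
definition "U = A \<union> \<nu> ` carrier G"
text \<open>Meant for the two parts of \<open>X\<close>: their traces on \<open>A\<close> are
  already invariant, so only the orbit of \<open>m\<close> has to be added to obtain sets invariant
  on \<open>U\<close>.\<close>

definition "orbit_closure Q = (Q \<inter> A) \<union> (if m \<in> Q then \<nu> ` carrier G else {})"

abbreviation "PB \<equiv> orbit_closure (Ppart X)"
abbreviation "CB \<equiv> orbit_closure (Cpart X)"

lemma act'_old: "x \<in> A \<Longrightarrow> act' g x = act g x"
  by (simp add: act'_def)

lemma act'_new: "h \<in> carrier G \<Longrightarrow> act' g (\<nu> h) = \<nu> (g \<otimes> h)"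
  using \<nu>_new \<nu>_inj by (simp add: act'_def)

lemma U_cases:
  assumes "x \<in> U"
  obtains "x \<in> A" | h where "h \<in> carrier G" "x = \<nu> h"
  using assms by (auto simp: U_def)

lemma act'_closed: "g \<in> carrier G \<Longrightarrow> x \<in> U \<Longrightarrow> act' g x \<in> U"
  by (erule U_cases) (auto simp: act'_old act'_new U_def free_action_onD(1)[OF action])

lemma act'_mult: "g \<in> carrier G \<Longrightarrow> h \<in> carrier G \<Longrightarrow> x \<in> U \<Longrightarrow> act' (g \<otimes> h) x = act' g (act' h x)"
  by (erule U_cases) (auto simp: act'_old act'_new m_assoc free_action_onD(1,2)[OF action])

lemma act'_one: "x \<in> U \<Longrightarrow> act' \<one> x = x"
  by (erule U_cases) (auto simp: act'_old act'_new free_action_onD(3)[OF action])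

lemma act'_free:
  assumes g: "g \<in> carrier G" and x: "x \<in> U" "act' g x = x"
  shows "g = \<one>"
  using x(1)
proof (cases rule: U_cases)
  case 1
  then show ?thesis using free_action_onD(4)[OF action g] x by (simp add: act'_old)
next
  case (2 h)
  then have "g \<otimes> h = h" using x g by (simp add: act'_new inj_on_eq_iff[OF \<nu>_inj])
  then show ?thesis using g 2 by simp
qed

lemma act'_inv: "g \<in> carrier G \<Longrightarrow> x \<in> U \<Longrightarrow> act' (inv g) (act' g x) = x"
  and act'_inv': "g \<in> carrier G \<Longrightarrow> x \<in> U \<Longrightarrow> act' g (act' (inv g) x) = x"
  using act'_mult[of "inv g" g x] act'_mult[of g "inv g" x] act'_one by simp_all

text \<open>Freeness as injectivity of the orbit map at \<open>x\<close>. It makes the group element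
  leading from one point of an orbit to another unique.\<close>

lemma act'_cancel:
  assumes "g \<in> carrier G" "h \<in> carrier G" "x \<in> U" "act' g x = act' h x"
  shows "g = h"
proof -
  have "act' (inv h \<otimes> g) x = x"
    using assms act'_mult[of "inv h" g x] act'_inv[of h x] by simp
  then have "inv h \<otimes> g = \<one>" using assms by (intro act'_free) auto
  then show ?thesis using assms by (metis inv_equality inv_inv inv_closed)
qed

lemma act'_inj: "g \<in> carrier G \<Longrightarrow> inj_on (act' g) U"
  by (rule inj_on_inverseI[where g = "act' (inv g)"]) (rule act'_inv)

lemma map_act':
  assumes "g \<in> carrier G" "h \<in> carrier G" "set xs \<subseteq> U"
  shows "map (act' g) (map (act' h) xs) = map (act' (g \<otimes> h)) xs"
  using assms act'_mult by auto

lemma act'_parts: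
  assumes g: "g \<in> carrier G" and x: "x \<in> A"
  shows "act' g x \<in> Ppart X \<longleftrightarrow> x \<in> Ppart X" "act' g x \<in> Cpart X \<longleftrightarrow> x \<in> Cpart X"
  using free_action_onD(5)[OF action g, of SymP "[x]"] free_action_onD(5)[OF action g, of SymC "[x]"] x
  by (simp_all add: act'_old)

lemma act'_A: "g \<in> carrier G \<Longrightarrow> x \<in> A \<Longrightarrow> act' g x \<in> A"
  by (simp add: act'_old free_action_onD(1)[OF action])

lemma act'_PB: "g \<in> carrier G \<Longrightarrow> x \<in> PB \<Longrightarrow> act' g x \<in> PB"
  and act'_CB: "g \<in> carrier G \<Longrightarrow> x \<in> CB \<Longrightarrow> act' g x \<in> CB"
  using act'_A act'_parts act'_new
  by (auto simp: orbit_closure_def simp del: mem_parts split: if_splits)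

lemma orbit_closure_U: "orbit_closure Q \<subseteq> U"
  by (auto simp: orbit_closure_def U_def)

lemma act'_PB_iff: "g \<in> carrier G \<Longrightarrow> x \<in> U \<Longrightarrow> act' g x \<in> PB \<longleftrightarrow> x \<in> PB"
  and act'_CB_iff: "g \<in> carrier G \<Longrightarrow> x \<in> U \<Longrightarrow> act' g x \<in> CB \<longleftrightarrow> x \<in> CB"
  using act'_PB act'_CB act'_inv inv_closed by metis+

lemma parts_cover: "Ppart X \<union> Cpart X = insert m A" and parts_disjoint: "Ppart X \<inter> Cpart X = {}"
  using DF_univ[OF X] DF_disjoint[OF X] univX by simp_all

lemma A_U: "A \<subseteq> U" and univX_U: "univ X \<subseteq> U"
  using \<nu>_one one_closed univX by (auto simp: U_def)

lemma PB_CB: "PB \<union> CB = U" "PB \<inter> CB = {}"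
proof -
  have "m \<in> Ppart X \<longleftrightarrow> m \<notin> Cpart X" "\<And>x. x \<in> A \<Longrightarrow> x \<in> Ppart X \<longleftrightarrow> x \<notin> Cpart X"
    using parts_cover parts_disjoint by blast+
  then show "PB \<union> CB = U" "PB \<inter> CB = {}"
    using \<nu>_new by (auto simp: orbit_closure_def U_def simp del: mem_parts)
qed

lemma orbit_closure_restrict:
  assumes "Q \<subseteq> univ X"
  shows "orbit_closure Q \<inter> univ X = Q"
proof -
  have "m \<in> \<nu> ` carrier G" using \<nu>_one one_closed by force
  moreover have "\<nu> ` carrier G \<inter> A = {}" using \<nu>_new by auto
  ultimately show ?thesis using assms mA unfolding univX orbit_closure_def by auto
qed

lemma PX: "Ppart X \<subseteq> univ X" and CX: "Cpart X \<subseteq> univ X"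
  using DF_univ[OF X] by blast+

lemma PB_X: "PB \<inter> univ X = Ppart X" and CB_X: "CB \<inter> univ X = Cpart X"
  using orbit_closure_restrict PX CX by blast+

lemma tilde_act':
  assumes "g \<in> carrier G" "R \<in> syms S" "set xs \<subseteq> A" "length xs = arity S R" "c \<in> A"
  shows "map (act' g) xs @ [act' g c] \<in> rel X (Tilde R) \<longleftrightarrow> xs @ [c] \<in> rel X (Tilde R)"
proof -
  have "map (act' g) xs = map (act g) xs" using assms act'_old by auto
  then show ?thesis
    using free_action_onD(5)[OF action assms(1), of "Tilde R" "xs @ [c]"] assms by (simp add: act'_old del: map_eq_conv)
qed

text \<open>What a fibre over \<open>t\<close> must satisfy so that its translate by \<open>g\<close> extends the fibre of \<open>X\<close>
  over \<open>act' g t\<close>, whenever the latter lies in \<open>X\<close>.\<close>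

definition "admissible t W \<longleftrightarrow> W \<in> F \<and> univ W = PB \<and>
  (\<forall>g\<in>carrier G. act' g t \<in> univ X \<longrightarrow> (\<forall>R\<in>syms S. \<forall>xs. set xs \<subseteq> Ppart X \<and> length xs = arity S R \<longrightarrow>
     (xs @ [act' g t] \<in> rel X (Tilde R) \<longleftrightarrow> map (act' (inv g)) xs \<in> rel W R)))"

lemma admissible_exists_if_P:
  assumes m: "m \<in> Ppart X" and t: "t \<in> CB"
  shows "\<exists>W. admissible t W"
proof -
  let ?B = "Ppart X \<inter> A"
  have P: "Ppart X = insert m ?B" using m PX univX by blast
  have "m \<notin> Cpart X" using m parts_disjoint by blast
  then have t': "t \<in> Cpart X" "t \<in> A" using t by (auto simp: orbit_closure_def simp del: mem_parts)
  have PBeq: "PB = ?B \<union> \<nu> ` carrier G" using m by (simp add: orbit_closure_def del: mem_parts)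
  have tg: "act' g t \<in> Cpart X" "act' g t \<in> A" if "g \<in> carrier G" for g
    using act'_parts(2) act'_A t' that by blast+
  \<comment> \<open>The requirement on the point \<open>\<nu> h\<close> in the fibre over
    \<open>t\<close>, found by moving everything with \<open>inv h\<close>: then
    \<open>\<nu> h\<close> goes to \<open>m\<close> and \<open>t\<close> to an old point, over which
    the fibre of \<open>X\<close> is given.\<close>
  define E where "E h = pullback S (act' (inv h)) (insert (\<nu> h) ?B) (fibre X (act' (inv h) t))" for h
  have B_act: "act' g x \<in> ?B" if "g \<in> carrier G" "x \<in> ?B" for g x
    using that act'_A act'_parts by blast
  have im: "act' (inv h) ` insert (\<nu> h) ?B \<subseteq> Ppart X" if h: "h \<in> carrier G" for h
    using B_act[of "inv h"] h act'_new[of h "inv h"] m \<nu>_one by (auto simp del: mem_parts)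
  have subU: "insert (\<nu> h) ?B \<subseteq> U" if "h \<in> carrier G" for h using that by (auto simp: U_def)
  have E: "E h \<in> F" if h: "h \<in> carrier G" for h
    unfolding E_def
    by (rule K_pullback[OF DF_fibre[OF X tg(1)]])
      (use h im[OF h] inj_on_subset[OF act'_inj subU[OF h]] in \<open>simp_all del: mem_parts\<close>)
  define Z where "Z = submodel (fibre X t) ?B"
  have Z: "Z \<in> F" unfolding Z_def by (rule K_submodel[OF DF_fibre[OF X t'(1)]]) auto
  \<comment> \<open>Among old points nothing depends on \<open>h\<close>, because the old action
    preserves the relations of \<open>X\<close>; so all \<open>E h\<close> extend the same
    \<open>Z\<close>.\<close>
  have EZ: "submodel (E h) ?B = Z" if h: "h \<in> carrier G" for h
  proof (rule model_eqI)
    fix R xs assume R: "R \<in> syms S" and xs: "set xs \<subseteq> univ (submodel (E h) ?B)" "length xs = arity S R"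
    then have "set xs \<subseteq> A" by auto
    from tilde_act'[OF inv_closed[OF h] R this xs(2) t'(2)]
    show "xs \<in> rel (submodel (E h) ?B) R \<longleftrightarrow> xs \<in> rel Z R"
      using xs R by (auto simp: E_def Z_def simp del: mem_parts)
  qed (use K_model E[OF h] Z in \<open>auto simp: Z_def intro: is_model_submodel\<close>)
  have "\<exists>W\<in>F. univ W = ?B \<union> \<nu> ` carrier G \<and> submodel W ?B = Z \<and>
      (\<forall>h\<in>carrier G. submodel W (insert (\<nu> h) ?B) = E h)"
    by (rule amalgam_of_one_point_extensions[OF F_union finG Z _ \<nu>_inj _ E _ EZ])
      (use \<nu>_new in \<open>auto simp: Z_def E_def\<close>)
  then obtain W where W: "W \<in> F" "univ W = PB" "\<And>h. h \<in> carrier G \<Longrightarrow> submodel W (insert (\<nu> h) ?B) = E h"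
    using PBeq by auto
  have "xs @ [act' g t] \<in> rel X (Tilde R) \<longleftrightarrow> map (act' (inv g)) xs \<in> rel W R"
    if g: "g \<in> carrier G" and R: "R \<in> syms S" and xs: "set xs \<subseteq> Ppart X" "length xs = arity S R" for g R xs
  proof -
    have xsU: "set xs \<subseteq> U" using xs PX univX_U by blast
    \<comment> \<open>The condition for \<open>g\<close> involves only points of \<open>?B\<close>
      and \<open>\<nu> (inv g)\<close>, so it is settled inside the single extension
      \<open>E (inv g)\<close>. Tuples containing several new points are not constrained.\<close>
    have act_x: "act' (inv g) x \<in> insert (\<nu> (inv g)) ?B" if "x \<in> Ppart X" for x
    proof (cases "x = m")
      case True
      then show ?thesis using g act'_new[of \<one> "inv g"] \<nu>_one by simp
    next
      case False
      then have "x \<in> ?B" using that P by blast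
      then show ?thesis using B_act[OF inv_closed[OF g]] by blast
    qed
    have sub: "set (map (act' (inv g)) xs) \<subseteq> insert (\<nu> (inv g)) ?B"
      using xs(1) act_x unfolding set_map by blast
    then have "map (act' (inv g)) xs \<in> rel W R \<longleftrightarrow> map (act' (inv g)) xs \<in> rel (E (inv g)) R"
      using W(3)[OF inv_closed[OF g]] submodel_simps(2)[of "map (act' (inv g)) xs" W "insert (\<nu> (inv g)) ?B" R] by metis
    also have "\<dots> \<longleftrightarrow> map (act' g) (map (act' (inv g)) xs) @ [act' g t] \<in> rel X (Tilde R)"
      using sub R xs g by (simp add: E_def del: mem_parts map_map)
    also have "map (act' g) (map (act' (inv g)) xs) = xs"
      using xsU act'_inv'[OF g] by (auto intro!: map_idI)
    finally show ?thesis by simp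
  qed
  with W have "admissible t W" unfolding admissible_def by blast
  then show ?thesis ..
qed

text \<open>The P-part does not grow, so one translated fibre of \<open>X\<close> serves. If
  \<open>t\<close> is old it is the fibre over \<open>t\<close> itself, and the conditions for the
  other group elements follow from the invariance of \<open>X\<close>; if \<open>t\<close> is new,
  exactly one element moves it into \<open>X\<close>, namely to \<open>m\<close>.\<close>

lemma admissible_exists_if_C:
  assumes m: "m \<in> Cpart X" and t: "t \<in> CB"
  shows "\<exists>W. admissible t W"
proof -
  have m': "m \<notin> Ppart X" using m parts_disjoint by blast
  then have PA: "Ppart X \<subseteq> A" using PX unfolding univX by blast
  then have PBeq: "PB = Ppart X" using m' by (auto simp: orbit_closure_def simp del: mem_parts)
  have tU: "t \<in> U" using t orbit_closure_U by blast
  \<comment> \<open>The element moving \<open>t\<close> to the point whose fibre is copied: the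
    identity for old \<open>t\<close>, and \<open>inv h\<close> for a new \<open>t\<close> of the
    form \<open>\<nu> h\<close>.\<close>
  obtain g0 where g0: "g0 \<in> carrier G" "act' g0 t \<in> Cpart X"
    and unique: "\<And>g. g \<in> carrier G \<Longrightarrow> act' g t \<in> univ X \<Longrightarrow> t \<notin> A \<Longrightarrow> g = g0"
    and g0_one: "t \<in> A \<Longrightarrow> g0 = \<one>"
  proof (cases "t \<in> A")
    case True
    then have "act' \<one> t \<in> Cpart X"
      using t \<nu>_new act'_one[OF tU] by (auto simp: orbit_closure_def simp del: mem_parts split: if_splits)
    with True show ?thesis by (intro that[of \<one>]) auto
  next
    case False
    then obtain h where h: "h \<in> carrier G" "t = \<nu> h" using tU by (auto simp: U_def)
    have im: "act' (inv h) t = m" using h act'_new[of h "inv h"] \<nu>_one by simp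
    have "g = inv h" if g: "g \<in> carrier G" "act' g t \<in> univ X" for g
    proof -
      have "\<nu> (g \<otimes> h) \<in> insert m A" using g h act'_new[of h g] univX by simp
      then have "\<nu> (g \<otimes> h) = m" using \<nu>_new[of "g \<otimes> h"] g h by simp
      then show ?thesis using im act'_cancel[of g "inv h" t] g h tU act'_new[of h g] by simp
    qed
    with False im h m show ?thesis by (intro that[of "inv h"]) auto
  qed
  define W where "W = pullback S (act' g0) PB (fibre X (act' g0 t))"
  have "act' g0 ` PB \<subseteq> Ppart X" using act'_PB[OF g0(1)] PBeq by blast
  then have W: "W \<in> F" unfolding W_def
    by (intro K_pullback[OF DF_fibre[OF X g0(2)]] inj_on_subset[OF act'_inj[OF g0(1)] orbit_closure_U])
      (simp_all del: mem_parts)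
  have "xs @ [act' g t] \<in> rel X (Tilde R) \<longleftrightarrow> map (act' (inv g)) xs \<in> rel W R"
    if g: "g \<in> carrier G" "act' g t \<in> univ X" and R: "R \<in> syms S"
      and xs: "set xs \<subseteq> Ppart X" "length xs = arity S R" for g R xs
  proof -
    have "set (map (act' (inv g)) xs) \<subseteq> PB"
      using xs act'_PB[OF inv_closed[OF g(1)]] PBeq by (auto simp del: mem_parts)
    then have W_iff: "map (act' (inv g)) xs \<in> rel W R \<longleftrightarrow>
        map (act' g0) (map (act' (inv g)) xs) @ [act' g0 t] \<in> rel X (Tilde R)"
      using R xs by (simp add: W_def del: map_map)
    show ?thesis
    proof (cases "t \<in> A")
      case True
      have xsA: "set xs \<subseteq> A" using xs PA by blast
      have eq: "map (act' g0) (map (act' (inv g)) xs) = map (act' (inv g)) xs"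
        using g0_one[OF True] act'_one act'_A[OF inv_closed[OF g(1)]] xsA A_U
        by (intro map_idI) auto
      have eq_t: "act' g0 t = act' (inv g) (act' g t)"
        using g0_one[OF True] act'_one[OF tU] act'_inv[OF g(1) tU] by simp
      show ?thesis
        unfolding W_iff eq eq_t tilde_act'[OF inv_closed[OF g(1)] R xsA xs(2) act'_A[OF g(1) True]] ..
    next
      case False
      have "set xs \<subseteq> U" using xs PX univX_U by blast
      then have "map (act' g0) (map (act' (inv g)) xs) = xs"
        using unique[OF g False] act'_inv'[OF g0(1)] by (auto intro!: map_idI)
      then show ?thesis using W_iff unique[OF g False] by simp
    qed
  qed
  with W have "admissible t W" unfolding admissible_def W_def by (simp del: mem_parts)
  then show ?thesis ..
qed

lemma admissible_exists: "t \<in> CB \<Longrightarrow> \<exists>W. admissible t W"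
  using admissible_exists_if_P admissible_exists_if_C parts_cover by blast

lemma extension_exists: "\<exists>B\<in>DF. univ B = U \<and> submodel B (univ X) = X \<and> free_action_on G D B U act'"
proof -
  obtain W where W: "\<And>t. t \<in> CB \<Longrightarrow> admissible t (W t)"
    using admissible_exists by metis
  \<comment> \<open>The predicate under \<open>SOME\<close> depends on \<open>c\<close> only through
    its orbit, so the same representative is picked along the whole orbit.\<close>
  define rep where "rep c = (SOME t. \<exists>g\<in>carrier G. t = act' g c)" for c
  define coset where "coset c = (SOME g. g \<in> carrier G \<and> act' g (rep c) = c)" for c
  have rep: "\<exists>g\<in>carrier G. rep c = act' g c" for c
    unfolding rep_def by (rule someI_ex) (use one_closed in blast)
  have rep_CB: "rep c \<in> CB" if "c \<in> CB" for c
    using rep[of c] act'_CB that by auto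
  have coset: "coset c \<in> carrier G" "act' (coset c) (rep c) = c" if c: "c \<in> CB" for c
  proof -
    obtain g where "g \<in> carrier G" "rep c = act' g c" using rep[of c] by blast
    then have "inv g \<in> carrier G \<and> act' (inv g) (rep c) = c"
      using act'_inv c orbit_closure_U by auto
    from someI[of "\<lambda>g. g \<in> carrier G \<and> act' g (rep c) = c", OF this]
    show "coset c \<in> carrier G" "act' (coset c) (rep c) = c" by (simp_all add: coset_def)
  qed
  have rep_act: "rep (act' g c) = rep c" if g: "g \<in> carrier G" and c: "c \<in> CB" for g c
  proof -
    have cU: "c \<in> U" using c orbit_closure_U by blast
    have "(\<exists>h\<in>carrier G. t = act' h (act' g c)) \<longleftrightarrow> (\<exists>h\<in>carrier G. t = act' h c)" for t
    proof
      assume "\<exists>h\<in>carrier G. t = act' h (act' g c)"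
      then obtain h where "h \<in> carrier G" "t = act' h (act' g c)" by blast
      then show "\<exists>h\<in>carrier G. t = act' h c"
        using act'_mult[of h g c] g cU by (intro bexI[of _ "h \<otimes> g"]) auto
    next
      assume "\<exists>h\<in>carrier G. t = act' h c"
      then obtain h where "h \<in> carrier G" "t = act' h c" by blast
      then show "\<exists>h\<in>carrier G. t = act' h (act' g c)"
        using act'_mult[of h "inv g" "act' g c"] act'_inv[OF g cU] act'_closed[OF g cU] g
        by (intro bexI[of _ "h \<otimes> inv g"]) auto
    qed
    then show ?thesis by (simp add: rep_def)
  qed
  \<comment> \<open>Both elements carry \<open>rep c\<close> to \<open>act' g c\<close>, so they
    coincide by freeness.\<close>
  have coset_act: "coset (act' g c) = g \<otimes> coset c" if g: "g \<in> carrier G" and c: "c \<in> CB" for g c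
  proof (rule act'_cancel)
    have gc: "act' g c \<in> CB" using act'_CB[OF g c] .
    show rU: "rep c \<in> U" using rep_CB[OF c] orbit_closure_U by blast
    show "coset (act' g c) \<in> carrier G" "g \<otimes> coset c \<in> carrier G" using coset(1)[OF gc] coset(1)[OF c] g by auto
    show "act' (coset (act' g c)) (rep c) = act' (g \<otimes> coset c) (rep c)"
      using coset(2)[OF gc] rep_act[OF g c] act'_mult[OF g coset(1)[OF c] rU] coset(2)[OF c] by simp
  qed
  \<comment> \<open>The fibre over the representative, translated by the element that leads to
    \<open>c\<close>.\<close>
  define V where "V c = pullback S (act' (inv (coset c))) PB (W (rep c))" for c
  have V: "V c \<in> F \<and> univ (V c) = PB" if c: "c \<in> CB" for c
  proof -
    have W': "W (rep c) \<in> F" "univ (W (rep c)) = PB"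
      using W[OF rep_CB[OF c]] by (auto simp: admissible_def simp del: mem_parts)
    have "V c \<in> F" unfolding V_def
      by (rule K_pullback[OF W'(1)])
        (use W'(2) act'_PB coset(1)[OF c] inj_on_subset[OF act'_inj orbit_closure_U] in \<open>auto simp del: mem_parts\<close>)
    then show ?thesis by (simp add: V_def)
  qed
  let ?B = "div_model PB CB V"
  have "finite U" using finG DF_finite[OF X] univX by (simp add: U_def)
  then have fin: "finite PB" "finite CB" using orbit_closure_U finite_subset by blast+
  have "?B \<in> DF" by (rule div_model_in_DF[OF fin PB_CB(2) V])
  moreover have univB: "univ ?B = U" using PB_CB(1) by simp
  moreover have "submodel ?B (univ X) = X"
  proof (rule submodel_div_model_eq[OF X PB_X CB_X V])
    fix c assume c: "c \<in> Cpart X"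
    then have cB: "c \<in> CB" using CB_X by blast
    show "submodel (V c) (Ppart X) = fibre X c"
    proof (rule model_eqI)
      fix R xs assume R: "R \<in> syms S" and xs: "set xs \<subseteq> univ (submodel (V c) (Ppart X))" "length xs = arity S R"
      \<comment> \<open>Admissibility of the fibre at the representative, taken at the group element
        \<open>coset c\<close>, says precisely that its translate extends the fibre of
        \<open>X\<close> over \<open>c\<close>.\<close>
      have "xs @ [act' (coset c) (rep c)] \<in> rel X (Tilde R) \<longleftrightarrow> map (act' (inv (coset c))) xs \<in> rel (W (rep c)) R"
      proof -
        have "act' (coset c) (rep c) \<in> univ X" using coset(2)[OF cB] c CX by auto
        moreover have "set xs \<subseteq> Ppart X \<and> length xs = arity S R" using xs by (simp del: mem_parts)
        ultimately show ?thesis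
          using W[OF rep_CB[OF cB]] coset(1)[OF cB] R unfolding admissible_def by blast
      qed
      then show "xs \<in> rel (submodel (V c) (Ppart X)) R \<longleftrightarrow> xs \<in> rel (fibre X c) R"
        using coset(2)[OF cB] R xs PB_X by (auto simp: V_def simp del: mem_parts)
    qed (use c V[OF cB] DF_fibre[OF X] K_model in \<open>auto intro: is_model_submodel simp del: mem_parts\<close>)
  qed
  moreover have "free_action_on G D ?B U act'"
    unfolding free_action_on_def
  proof (intro conjI ballI allI impI)
    fix g T zs assume g: "g \<in> carrier G" and T: "T \<in> syms D" and zs: "set zs \<subseteq> U \<and> length zs = arity D T"
    show "map (act' g) zs \<in> rel ?B T \<longleftrightarrow> zs \<in> rel ?B T"
    proof (cases T)
      case (Tilde R)
      then obtain xs c where zs_eq: "zs = xs @ [c]" using zs by (cases zs rule: rev_cases) auto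
      have R: "R \<in> syms S" and xs: "set xs \<subseteq> U" "length xs = arity S R" and cU: "c \<in> U"
        using T Tilde zs zs_eq by auto
      have "map (act' g) xs \<in> rel (V (act' g c)) R \<longleftrightarrow> xs \<in> rel (V c) R" if c: "c \<in> CB"
      proof -
        \<comment> \<open>The fibre over \<open>act' g c\<close> is pulled back along the inverse of
          \<open>g \<otimes> coset c\<close>, which absorbs the \<open>g\<close> applied to the
          tuple.\<close>
        have "inv (g \<otimes> coset c) \<otimes> g = inv (coset c)"
          using g coset(1)[OF c] by (simp add: inv_mult_group m_assoc)
        then have "map (act' (inv (g \<otimes> coset c))) (map (act' g) xs) = map (act' (inv (coset c))) xs"
          using map_act'[of "inv (g \<otimes> coset c)" g xs] g coset(1)[OF c] xs by simp
        moreover have "set (map (act' g) xs) \<subseteq> PB \<longleftrightarrow> set xs \<subseteq> PB"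
          using act'_PB_iff[OF g] xs by auto
        ultimately show ?thesis
          using R xs by (simp add: V_def coset_act[OF g c] rep_act[OF g c] del: map_map map_eq_conv)
      qed
      then show ?thesis using act'_CB_iff[OF g cU] by (auto simp: zs_eq Tilde)
    next
      case SymP
      then obtain x where "zs = [x]" "x \<in> U" using zs by (auto simp: length_Suc_conv)
      then show ?thesis using act'_PB_iff[OF g] by (simp add: SymP del: mem_parts)
    next
      case SymC
      then obtain x where "zs = [x]" "x \<in> U" using zs by (auto simp: length_Suc_conv)
      then show ?thesis using act'_CB_iff[OF g] by (simp add: SymC del: mem_parts)
    qed
  qed (use act'_closed act'_mult act'_one act'_free in auto)
  ultimately show ?thesis by blast
qed

end

section \<open>Assembling the action on the whole limit\<close>

context div_class
begin

lemma free_action_extension: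
  fixes G :: "'g monoid"
  assumes "group G" "finite (carrier G)" "X \<in> DF" "univ X = insert m A" "m \<notin> A" "free_action_on G D X A act"
  obtains B act' where "B \<in> DF" "univ X \<subseteq> univ B" "submodel B (univ X) = X"
    "free_action_on G D B (univ B) act'" "\<And>g x. x \<in> A \<Longrightarrow> act' g x = act g x"
proof -
  interpret G: group G by (rule assms(1))
  obtain b where b: "\<And>x. x \<in> univ X \<Longrightarrow> x < b"
    using finite_nat_set_iff_bounded DF_finite[OF assms(3)] by metis
  obtain f :: "'g \<Rightarrow> nat" where f: "inj_on f (carrier G)"
    using finite_imp_inj_to_nat_seg[OF assms(2)] by metis
  \<comment> \<open>The identity must name the given point \<open>m\<close>; the other elements are
    numbered injectively by \<open>f\<close> and shifted above all points of \<open>X\<close>, so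
    that no old point is hit.\<close>
  define \<nu> where "\<nu> g = (if g = \<one>\<^bsub>G\<^esub> then m else b + f g)" for g
  interpret free_extension S F G X A m act \<nu>
  proof
    show "inj_on \<nu> (carrier G)"
    proof (rule inj_onI)
      fix g h assume *: "g \<in> carrier G" "h \<in> carrier G" "\<nu> g = \<nu> h"
      have "m < b" using b assms(4) by auto
      then show "g = h" using * f by (auto simp: \<nu>_def inj_on_eq_iff split: if_splits)
    qed
    show "\<nu> g \<notin> A" if "g \<in> carrier G" for g
    proof
      assume "\<nu> g \<in> A"
      then have "\<nu> g < b" "\<nu> g \<noteq> m" using b assms(4,5) by auto
      then show False by (simp add: \<nu>_def split: if_splits)
    qed
    show "\<nu> \<one>\<^bsub>G\<^esub> = m" by (simp add: \<nu>_def)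
  qed (fact assms)+
  show ?thesis using extension_exists univX_U act'_old that by metis
qed

text \<open>The extension by one orbit is an abstract model \<open>B\<close> containing
  \<open>X\<close>. Richness realises it inside \<open>N\<close> with \<open>X\<close> fixed
  pointwise, so conjugating its action into \<open>N\<close> leaves the part already defined
  untouched.\<close>

lemma free_action_exists:
  fixes G :: "'g monoid" and N :: "('r div_sym, nat) model"
  assumes G: "group G" "finite (carrier G)" and rich: "rich D DF N"
    and sub: "\<And>A. A \<subseteq> univ N \<Longrightarrow> finite A \<Longrightarrow> submodel N A \<in> DF"
  shows "\<exists>act. free_action_on G D N (univ N) act"
proof -
  interpret group G by (rule G)
  let ?ok = "\<lambda>p. fst p \<subseteq> univ N \<and> finite (fst p) \<and> free_action_on G D N (fst p) (snd p)"
  let ?below = "\<lambda>p q. fst p \<subseteq> fst q \<and> (\<forall>g\<in>carrier G. \<forall>x\<in>fst p. snd q g x = snd p g x)"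
  have dense: "\<exists>q. ?ok q \<and> ?below p q \<and> (n \<in> univ N \<longrightarrow> n \<in> fst q)" if p: "?ok p" for n p
  proof (cases "n \<in> univ N \<and> n \<notin> fst p")
    case True
    obtain A act where Aact: "p = (A, act)" by (cases p)
    define X where "X = submodel N (insert n A)"
    have A: "A \<subseteq> univ N" "finite A" "n \<notin> A" "n \<in> univ N" using p True Aact by auto
    have X: "X \<in> DF" unfolding X_def by (rule sub) (use A in auto)
    have univX: "univ X = insert n A" by (simp add: X_def)
    have "free_action_on G D X A act"
      unfolding X_def using p Aact by (subst free_action_on_submodel) auto
    then obtain B act' where B: "B \<in> DF" "univ X \<subseteq> univ B" "submodel B (univ X) = X"
      and act': "free_action_on G D B (univ B) act'" "\<And>g x. x \<in> A \<Longrightarrow> act' g x = act g x"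
      using free_action_extension[OF G X univX A(3)] by metis
    have "embedding D (\<lambda>x. x) (submodel B (univ X)) N"
      unfolding B(3) by (rule embedding_inclusion) (use A in \<open>auto simp: X_def\<close>)
    then obtain h where h: "embedding D h B N" "\<And>x. x \<in> univ X \<Longrightarrow> h x = x"
      using rich B(1,2) unfolding rich_def by metis
    let ?act = "\<lambda>g y. h (act' g (inv_into (univ B) h y))"
    have "inv_into (univ B) h x = x" if "x \<in> univ X" for x
      using inv_into_f_f[OF embeddingD(2)[OF h(1)], of x] h(2)[OF that] that B(2) by auto
    moreover have "act g x \<in> A" if "g \<in> carrier G" "x \<in> A" for g x
      using free_action_onD(1)[of G D N A act g x] that p Aact by simp
    ultimately have "?act g x = act g x" if "g \<in> carrier G" "x \<in> A" for g x
      using that act'(2) h(2) univX by simp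
    moreover have "insert n A \<subseteq> h ` univ B" using h(2) B(2) univX by force
    moreover have "h ` univ B \<subseteq> univ N" using embeddingD(1)[OF h(1)] .
    ultimately show ?thesis
      using free_action_on_image[OF act'(1) h(1)] DF_finite[OF B(1)]
      by (intro exI[of _ "(h ` univ B, ?act)"]) (auto simp: Aact)
  qed (use p in auto)
  have p0: "?ok ({}, \<lambda>g x. x)" by (auto simp: free_action_on_def)
  obtain s where s: "\<And>n. ?ok (s n)" "\<And>m n. m \<le> n \<Longrightarrow> ?below (s m) (s n)"
    "\<And>n. n \<in> univ N \<longrightarrow> n \<in> fst (s (Suc n))"
    by (rule generic_chain[of ?ok "({}, \<lambda>g x. x)" ?below "\<lambda>n q. n \<in> univ N \<longrightarrow> n \<in> fst q"])
      (use p0 dense in \<open>auto simp: subset_iff\<close>)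
  \<comment> \<open>The point \<open>x\<close> has entered by stage \<open>Suc x\<close>, where
    requirement \<open>x\<close> is met; the stages that contain \<open>x\<close> agree on it, so
    any of them gives the same value.\<close>
  define act where "act g x = snd (s (Suc x)) g x" for g x
  have act: "free_action_on G D N (fst (s n)) act" for n
  proof (rule free_action_on_cong)
    show "free_action_on G D N (fst (s n)) (snd (s n))" using s(1) by blast
    fix g x assume g: "g \<in> carrier G" and x: "x \<in> fst (s n)"
    then have x': "x \<in> fst (s (Suc x))" using s(1)[of n] s(3) by blast
    show "act g x = snd (s n) g x"
      using s(2)[of n "Suc x"] s(2)[of "Suc x" n] g x x' unfolding act_def by (metis nat_le_linear)
  qed auto
  have cover: "\<exists>n. B \<subseteq> fst (s n)" if "B \<subseteq> univ N" "finite B" for B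
  proof -
    have "B \<subseteq> (\<Union>n. fst (s n))" using that s(3) by blast
    then show ?thesis using finite_subset_chain[of "\<lambda>n. fst (s n)" B] s(2) that(2) by metis
  qed
  have point: "\<exists>n. x \<in> fst (s n)" if "x \<in> univ N" for x using that s(3) by blast
  have "free_action_on G D N (univ N) act"
    unfolding free_action_on_def
  proof (intro conjI ballI allI impI)
    fix g R xs assume "g \<in> carrier G" "R \<in> syms D" "set xs \<subseteq> univ N \<and> length xs = arity D R"
    then show "map (act g) xs \<in> rel N R \<longleftrightarrow> xs \<in> rel N R"
      using cover[of "set xs"] free_action_onD(5)[OF act] by blast
  next
    fix g x assume "g \<in> carrier G" "x \<in> univ N"
    then show "act g x \<in> univ N" using point s(1) free_action_onD(1)[OF act] by blast
  next
    fix g h x assume "g \<in> carrier G" "h \<in> carrier G" "x \<in> univ N"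
    then show "act (g \<otimes>\<^bsub>G\<^esub> h) x = act g (act h x)" using point free_action_onD(2)[OF act] by blast
  next
    fix x assume "x \<in> univ N"
    then show "act \<one>\<^bsub>G\<^esub> x = x" using point free_action_onD(3)[OF act] by blast
  next
    fix g x assume "g \<in> carrier G" "x \<in> univ N" "act g x = x"
    then show "g = \<one>\<^bsub>G\<^esub>" using point free_action_onD(4)[OF act] by blast
  qed
  then show ?thesis by blast
qed

text \<open>The extension step needs points that are natural numbers, so it is run on a copy
  \<open>N\<close> of the countable \<open>M\<close>, and the action is conjugated back. Richness
  and the age suffice, so every limit is covered directly, without an isomorphism between
  limits.\<close>

lemma limit_acts_freely:
  fixes G :: "'g monoid" and M :: "('r div_sym, 'a) model"
  assumes M: "fraisse_limit D DF M" and G: "group G" "finite (carrier G)"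
  shows "acts_freely G D M"
proof -
  have model: "is_model D M" and count: "countable (univ M)" and age: "age D M = DF"
    using M by (auto simp: fraisse_limit_def)
  let ?e = "to_nat_on (univ M)"
  define i where "i = inv_into (univ M) ?e"
  define N where "N = pullback D i (?e ` univ M) M"
  have bij: "bij_betw i (?e ` univ M) (univ M)"
    unfolding i_def by (rule bij_betw_inv_into) (rule inj_on_imp_bij_betw[OF inj_on_to_nat_on[OF count]])
  have iso: "isomorphism D i N M"
    unfolding isomorphism_def N_def using embedding_pullback[of i "?e ` univ M" M D] bij
    by (simp add: bij_betw_def)
  then have i: "embedding D i N M" and im: "i ` univ N = univ M" by (auto simp: isomorphism_def)
  define j where "j = inv_into (univ N) i"
  have j: "embedding D j M N" using isomorphism_inverse[OF iso] by (simp add: j_def isomorphism_def)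
  have ji: "j (i x) = x" if "x \<in> univ N" for x
    using that embeddingD(2)[OF i] by (simp add: j_def)
  have rich: "rich D DF N" unfolding rich_def
  proof (intro ballI allI impI, elim conjE)
    fix B A f assume B: "B \<in> DF" and A: "A \<subseteq> univ B" and f: "embedding D f (submodel B A) N"
    obtain h where h: "embedding D h B M" "\<And>a. a \<in> A \<Longrightarrow> h a = i (f a)"
      using rich_if_limit[OF DF.fmc M] B A embedding_comp[OF f i] unfolding rich_def by metis
    have "j (h a) = f a" if "a \<in> A" for a
      using h(2)[OF that] ji embeddingD(1)[OF f] that by auto
    with embedding_comp[OF h(1) j] show "\<exists>h. embedding D h B N \<and> (\<forall>a\<in>A. h a = f a)" by blast
  qed
  have sub: "submodel N A \<in> DF" if "A \<subseteq> univ N" "finite A" for A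
  proof -
    have "is_model D (submodel N A)" unfolding N_def by (intro is_model_submodel is_model_pullback)
    then show ?thesis
      using that embedding_submodel_domain[OF i that(1)] unfolding age[symmetric] age_def by auto
  qed
  obtain act where act: "free_action_on G D N (univ N) act"
    using free_action_exists[OF G rich sub] by blast
  show ?thesis
    by (rule acts_freely_if_free_action_on[OF G(1)])
      (use free_action_on_image[OF act i] im in simp)
qed

end

theorem theorem4:
  fixes S :: "'r signature" and F :: "('r, nat) model set"
  assumes "countable (syms S)"
    and "fraisse_class S F"
    and "strong_amalgamation S F"
    and "univ ` F \<noteq> {{}}"
  shows "fraisse_class (div_signature S) (diversification S F) \<and>
    (\<exists>L :: ('r div_sym, nat) model.
       fraisse_limit (div_signature S) (diversification S F) L) \<and>
    (\<forall>M :: ('r div_sym, 'a) model.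
       fraisse_limit (div_signature S) (diversification S F) M \<longrightarrow>
       (\<forall>G :: 'g monoid. group G \<and> finite (carrier G) \<longrightarrow>
          acts_freely G (div_signature S) M))"
proof -
  interpret hereditary_class S F
    using assms(2) by unfold_locales (auto simp: fraisse_class_def)
  interpret div_class S F
    using assms union_amalgamation_if_strong countable_class
    by unfold_locales (auto simp: fraisse_class_def)
  show ?thesis
    using DF_fraisse DF_limit_exists limit_acts_freely by blast
qed

end
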